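(* For any integers $s,t,k\ge 1$, $\mathrm{ex}(n,L_{s,t}(k))=O(n^{1+\frac{s}{sk+1}})$ as $n\to\infty$, where the implied constant may depend on $s,t,k$.
   Context: For a graph $H$, $\mathrm{ex}(n,H)$ is the maximum number of edges in an $n$-vertex graph containing no copy of $H$ as a subgraph. For a graph $F$ with a set of roots $R\subsetneq V(F)$, the (rooted) $t$-blowup of $F$ is the graph obtained by taking $t$ vertex-disjoint copies of $F$ and identifying the different copies of $v$ for each $v\in R$. $L_{s,1}(k)$ is the graph with vertices $u$, $v$, $w_{i,j}$ ($1\le i\le k$, $1\le j\le s$) and edges $uv$, $vw_{1,j}$ ($1\le j\le s$), $w_{i,j}w_{i+1,j}$ ($1\le i\le k-1$, $1\le j\le s$), with roots $u,w_{k,1},\dots,w_{k,s}$. $L_{s,t}(k)$ is the rooted $t$-blowup of $L_{s,1}(k)$. Equivalently, $L_{s,t}(k)$ is obtained from $K_{s,t}$ by replacing its edges by internally disjoint paths of length $k$ and then adding an extra vertex joined to all vertices of the part of size $t$. *)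

theory Defs
  imports Complex_Main "HOL-Library.Landau_Symbols"
begin

text \<open>A graph is a pair of a vertex set and an edge set, each edge being a two-element set.\<close>

type_synonym 'a graph = "'a set \<times> 'a set set"

abbreviation verts :: "'a graph \<Rightarrow> 'a set" where "verts \<equiv> fst"
abbreviation edges :: "'a graph \<Rightarrow> 'a set set" where "edges \<equiv> snd"

definition simple_graph :: "'a graph \<Rightarrow> bool" where
  "simple_graph G \<longleftrightarrow> finite (verts G) \<and> (\<forall>e\<in>edges G. e \<subseteq> verts G \<and> card e = 2)"

text \<open>Copies are subgraphs, not necessarily induced.\<close>

definition contains_copy :: "'a graph \<Rightarrow> 'b graph \<Rightarrow> bool" where
  "contains_copy G H \<longleftrightarrow>
     (\<exists>f. inj_on f (verts H) \<and> f ` verts H \<subseteq> verts G \<and> (\<forall>e\<in>edges H. f ` e \<in> edges G))"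

text \<open>Every finite graph is isomorphic to one whose vertices are natural numbers, so it is enough
  to range over the latter. When \<open>H\<close> has an edge, the maximum is over a nonempty
  finite set; see \<open>ex_candidates\<close> below.\<close>

definition ex_number :: "nat \<Rightarrow> 'b graph \<Rightarrow> nat" where
  "ex_number n H =
     Max {card (edges G) | G :: nat graph.
            simple_graph G \<and> card (verts G) = n \<and> \<not> contains_copy G H}"

text \<open>In the \<open>t\<close>-blowup of \<open>F\<close> with root set \<open>R\<close>, the vertex \<open>Inl v\<close> is the common copy of a root
  \<open>v\<close>, and \<open>Inr (v, i)\<close> is the \<open>i\<close>-th copy of a non-root \<open>v\<close>.\<close>

definition blowup_vertex :: "'a set \<Rightarrow> nat \<Rightarrow> 'a \<Rightarrow> 'a + 'a \<times> nat" where
  "blowup_vertex R i v = (if v \<in> R then Inl v else Inr (v, i))"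

definition rooted_blowup :: "nat \<Rightarrow> 'a graph \<Rightarrow> 'a set \<Rightarrow> ('a + 'a \<times> nat) graph" where
  "rooted_blowup t F R =
     ((\<Union>i<t. blowup_vertex R i ` verts F),
      (\<Union>i<t. (\<lambda>e. blowup_vertex R i ` e) ` edges F))"

datatype lvertex = LU | LV | LW nat nat

definition L1_graph :: "nat \<Rightarrow> nat \<Rightarrow> lvertex graph" where
  "L1_graph s k =
     ({LU, LV} \<union> {LW i j | i j. 1 \<le> i \<and> i \<le> k \<and> 1 \<le> j \<and> j \<le> s},
      {{LU, LV}}
      \<union> {{LV, LW 1 j} | j. 1 \<le> j \<and> j \<le> s}
      \<union> {{LW i j, LW (i + 1) j} | i j. 1 \<le> i \<and> i \<le> k - 1 \<and> 1 \<le> j \<and> j \<le> s})"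

definition L1_roots :: "nat \<Rightarrow> nat \<Rightarrow> lvertex set" where
  "L1_roots s k = {LU} \<union> {LW k j | j. 1 \<le> j \<and> j \<le> s}"

definition L_graph :: "nat \<Rightarrow> nat \<Rightarrow> nat \<Rightarrow> (lvertex + lvertex \<times> nat) graph" where
  "L_graph s t k = rooted_blowup t (L1_graph s k) (L1_roots s k)"

lemma ex_candidates:
  fixes H :: "'b graph" and n :: nat
  assumes "edges H \<noteq> {}"
  defines "C \<equiv> {card (edges G) | G :: nat graph.
                  simple_graph G \<and> card (verts G) = n \<and> \<not> contains_copy G H}"
  shows "finite C" "C \<noteq> {}"
proof -
  have "C \<subseteq> {..2 ^ n}"
  proof
    fix c assume "c \<in> C"
    then obtain G :: "nat graph" where G: "simple_graph G" "card (verts G) = n" "c = card (edges G)"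
      unfolding C_def by blast
    then have "edges G \<subseteq> Pow (verts G)" "finite (verts G)"
      unfolding simple_graph_def by auto
    then have "card (edges G) \<le> card (Pow (verts G))"
      by (intro card_mono) auto
    then show "c \<in> {..2 ^ n}" using G \<open>finite (verts G)\<close> by (simp add: card_Pow)
  qed
  then show "finite C" by (rule finite_subset) simp
  have "simple_graph ({..<n}, {} :: nat set set)" "\<not> contains_copy ({..<n}, {} :: nat set set) H"
    using assms(1) by (auto simp: simple_graph_def contains_copy_def)
  then have "card (edges ({..<n}, {} :: nat set set)) \<in> C"
    unfolding C_def by (intro CollectI exI[of _ "({..<n}, {} :: nat set set)"]) simp
  then show "C \<noteq> {}" by blast
qed

lemma L1_graph_simple: "k \<ge> 1 \<Longrightarrow> simple_graph (L1_graph s k)"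
proof -
  assume k: "k \<ge> 1"
  have "{LW i j | i j. 1 \<le> i \<and> i \<le> k \<and> 1 \<le> j \<and> j \<le> s} \<subseteq> (\<lambda>(i, j). LW i j) ` ({..k} \<times> {..s})"
    by auto
  then have "finite {LW i j | i j. 1 \<le> i \<and> i \<le> k \<and> 1 \<le> j \<and> j \<le> s}"
    by (rule finite_subset) simp
  with k show ?thesis
    by (auto simp: simple_graph_def L1_graph_def card_insert_if)
qed

lemma inj_blowup_vertex: "inj (blowup_vertex R i)"
  by (auto simp: inj_def blowup_vertex_def split: if_splits)

lemma rooted_blowup_simple: "simple_graph F \<Longrightarrow> simple_graph (rooted_blowup t F R)"
  unfolding simple_graph_def rooted_blowup_def
  by (auto simp: card_image[OF inj_on_subset[OF inj_blowup_vertex]])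

lemma L1_roots_psubset: "k \<ge> 1 \<Longrightarrow> L1_roots s k \<subset> verts (L1_graph s k)"
  by (auto simp: L1_roots_def L1_graph_def)

lemma L_graph_simple: "k \<ge> 1 \<Longrightarrow> simple_graph (L_graph s t k)"
  unfolding L_graph_def by (intro rooted_blowup_simple L1_graph_simple)

lemma L_graph_has_edge: "t \<ge> 1 \<Longrightarrow> edges (L_graph s t k) \<noteq> {}"
  by (auto simp: L_graph_def rooted_blowup_def L1_graph_def intro!: exI[of _ 0])

end

theory Submission
  imports Defs "HOL-Analysis.Convex"
begin

text \<open>
  Pass to a subgraph on \<open>n\<close> vertices with all degrees between \<open>d\<close> and \<open>K d\<close>, where
  \<open>d \<ge> A n powr (s / (s k + 1))\<close> with \<open>A\<close> large. Let \<open>h j\<close> be the number of closed walks of length \<open>2 j\<close>;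
  this sequence is log-convex.

  If \<open>h k\<close> is much larger than \<open>d * h (k - 1)\<close>, then log-convexity of the number of closed walks at each single
  vertex and the Cauchy-Schwarz inequality show that almost all closed walks of length \<open>2 k\<close> are cycles, and that
  almost always two antipodal vertices are joined by \<open>k\<close>-paths avoiding any prescribed bounded set. Viewing such a
  cycle as a pair of \<open>k\<close>-walks from \<open>u\<close> to \<open>y\<close>, some \<open>(u, y)\<close> has \<open>s + t\<close> walks that are pairwise of this
  kind. Second vertices of \<open>t\<close> of them serve as the copies of \<open>v\<close>, penultimate vertices of the others as the
  \<open>w k j\<close>, and the connecting \<open>k\<close>-paths are chosen greedily.

  Otherwise \<open>h j \<le> n (c d)^j\<close> for all \<open>j \<le> k\<close>, so typically two vertices are joined by a bounded number of walks of
  each length up to \<open>k\<close>. Counting copies of \<open>L1_graph s k\<close> (spiders) with this property, some choice of the roots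
  has many of them, and each meets boundedly many others outside the roots, so \<open>t\<close> of them are disjoint.
\<close>

section \<open>Walks\<close>

text \<open>The exponent marks where spiders outnumber choices of roots: there are about n d (d^k)^s
  spiders and n^(s+1) choices, so an average choice has many spiders once d^(s k + 1) exceeds a
  large constant times n^s. The obstacle is that spiders with common roots may cluster at few
  vertices. Now h j is the sum, over ordered pairs of vertices, of the squared number of j-walks
  between them, while there are at least n d^j walks of length j; so h j <= n (c d)^j says that an
  average j-walk has boundedly many parallel ones, which rules clustering out. By log-convexity the
  ratios h (j + 1) / h j increase, so if this bound fails for some j <= k, then already h k / h (k -
  1) exceeds c d. Testing this one ratio therefore separates the two cases. Almost regularity enters
  twice: the upper degree bound makes degenerate closed walks rare, and both bounds together fix the
  number of j-walks from each vertex up to a constant factor. Since a nonempty vertex set gives A <=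
  d, no separate argument is needed for small subgraphs.\<close>

locale finite_simple =
  fixes V :: "'a set" and E :: "'a \<Rightarrow> 'a \<Rightarrow> bool"
  assumes finite_V: "finite V"
    and E_sym: "E x y \<Longrightarrow> E y x"
    and E_irrefl: "\<not> E x x"
    and E_in: "E x y \<Longrightarrow> x \<in> V"
begin

lemma E_in2: "E x y \<Longrightarrow> y \<in> V"
  using E_sym E_in by blast

definition walks :: "nat \<Rightarrow> 'a list set" where
  "walks n = {p. length p = Suc n \<and> set p \<subseteq> V \<and> (\<forall>i<n. E (p ! i) (p ! Suc i))}"

definition walks_from :: "nat \<Rightarrow> 'a \<Rightarrow> 'a list set" where
  "walks_from n x = {p \<in> walks n. p ! 0 = x}"

definition walks_betw :: "nat \<Rightarrow> 'a \<Rightarrow> 'a \<Rightarrow> 'a list set" where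
  "walks_betw n x y = {p \<in> walks n. p ! 0 = x \<and> p ! n = y}"

definition num_walks :: "nat \<Rightarrow> 'a \<Rightarrow> 'a \<Rightarrow> real" where
  "num_walks n x y = real (card (walks_betw n x y))"

lemma finite_walks [simp]: "finite (walks n)"
  by (rule finite_subset[OF _ finite_lists_length_eq[OF finite_V, of "Suc n"]])
    (auto simp: walks_def)

lemma finite_walks_from [simp]: "finite (walks_from n x)"
  by (simp add: walks_from_def)

lemma finite_walks_betw [simp]: "finite (walks_betw n x y)"
  by (simp add: walks_betw_def)

lemma num_walks_nonneg [simp]: "num_walks n x y \<ge> 0"
  by (simp add: num_walks_def)

lemma walks_length: "p \<in> walks n \<Longrightarrow> length p = Suc n"
  by (simp add: walks_def)

lemma walks_nth_in: "p \<in> walks n \<Longrightarrow> i \<le> n \<Longrightarrow> p ! i \<in> V"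
  by (auto simp: walks_def subset_iff)

lemma walks_adj: "p \<in> walks n \<Longrightarrow> i < n \<Longrightarrow> E (p ! i) (p ! Suc i)"
  by (auto simp: walks_def)

lemma take_walks: "p \<in> walks n \<Longrightarrow> a \<le> n \<Longrightarrow> take (Suc a) p \<in> walks a"
  by (auto simp: walks_def dest: in_set_takeD)

lemma drop_walks: "p \<in> walks n \<Longrightarrow> a \<le> n \<Longrightarrow> drop a p \<in> walks (n - a)"
  by (auto simp: walks_def dest: in_set_dropD)

lemma append_walks:
  assumes "q \<in> walks a" "r \<in> walks b" "q ! a = r ! 0"
  shows "q @ tl r \<in> walks (a + b)"
proof -
  have len: "length q = Suc a" "length r = Suc b" using assms by (auto simp: walks_def)
  have "E ((q @ tl r) ! i) ((q @ tl r) ! Suc i)" if "i < a + b" for i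
  proof (cases "i < a")
    case True
    then show ?thesis using assms(1) len by (simp add: nth_append walks_def)
  next
    case False
    then obtain c where c: "i = a + c" using le_Suc_ex not_less by blast
    have "E (r ! c) (r ! Suc c)" using assms(2) that c by (simp add: walks_def)
    then show ?thesis using c len assms(3) that
      by (cases c) (auto simp: nth_append nth_tl)
  qed
  moreover have "set (tl r) \<subseteq> V" using assms(2) by (auto simp: walks_def dest: list.set_sel(2)[rotated])
  ultimately show ?thesis using assms len by (auto simp: walks_def)
qed

lemma rev_walks: 
  assumes "p \<in> walks n" shows "rev p \<in> walks n"
proof -
  have len: "length p = Suc n" using assms by (simp add: walks_def)
  have "E (rev p ! i) (rev p ! Suc i)" if "i < n" for i
  proof -
    have "E (p ! (n - Suc i)) (p ! Suc (n - Suc i))" using assms that by (intro walks_adj) auto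
    then show ?thesis using that len E_sym by (simp add: rev_nth Suc_diff_Suc)
  qed
  then show ?thesis using assms by (auto simp: walks_def)
qed

text \<open>Both halves keep the vertex at position a, so they are glued as \<open>q @ tl r\<close>.
  Arbitrary conditions \<open>Q\<close> and \<open>R\<close> on the halves are carried along so that
  the cut can be repeated inside a half.\<close>

lemma card_walks_cut:
  assumes "a \<le> n"
  shows "card {p \<in> walks n. p ! a = z \<and> Q (take (Suc a) p) \<and> R (drop a p)}
    = card {q \<in> walks a. q ! a = z \<and> Q q} * card {r \<in> walks (n - a). r ! 0 = z \<and> R r}"
proof -
  have "bij_betw (\<lambda>p. (take (Suc a) p, drop a p))
     {p \<in> walks n. p ! a = z \<and> Q (take (Suc a) p) \<and> R (drop a p)}
     ({q \<in> walks a. q ! a = z \<and> Q q} \<times> {r \<in> walks (n - a). r ! 0 = z \<and> R r})"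
  proof (rule bij_betw_byWitness[where f' = "\<lambda>(q, r). q @ tl r"])
    show "\<forall>p\<in>{p \<in> walks n. p ! a = z \<and> Q (take (Suc a) p) \<and> R (drop a p)}.
       (case (take (Suc a) p, drop a p) of (q, r) \<Rightarrow> q @ tl r) = p"
      by (auto simp: tl_drop drop_Suc[symmetric])
    show "\<forall>qr\<in>{q \<in> walks a. q ! a = z \<and> Q q} \<times> {r \<in> walks (n - a). r ! 0 = z \<and> R r}.
       (take (Suc a) (case qr of (q, r) \<Rightarrow> q @ tl r), drop a (case qr of (q, r) \<Rightarrow> q @ tl r)) = qr"
    proof clarify
      fix q r assume *: "q \<in> walks a" "r \<in> walks (n - a)" "z = q ! a" "r ! 0 = q ! a"
      then have len: "length q = Suc a" "r \<noteq> []" by (auto simp: walks_def)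
      have "drop a q = [q ! a]" using len Cons_nth_drop_Suc[of a q] by simp
      then have "drop a (q @ tl r) = q ! a # tl r" using len by simp
      also have "\<dots> = r" using len *(4) by (cases r) auto
      finally show "take (Suc a) (q @ tl r) = q \<and> drop a (q @ tl r) = r" using len by simp
    qed
    show "(\<lambda>p. (take (Suc a) p, drop a p)) ` {p \<in> walks n. p ! a = z \<and> Q (take (Suc a) p) \<and> R (drop a p)}
       \<subseteq> {q \<in> walks a. q ! a = z \<and> Q q} \<times> {r \<in> walks (n - a). r ! 0 = z \<and> R r}"
      using assms by (auto simp: take_walks drop_walks walks_length)
    show "(\<lambda>(q, r). q @ tl r) ` ({q \<in> walks a. q ! a = z \<and> Q q} \<times> {r \<in> walks (n - a). r ! 0 = z \<and> R r})
       \<subseteq> {p \<in> walks n. p ! a = z \<and> Q (take (Suc a) p) \<and> R (drop a p)}"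
    proof clarify
      fix q r assume *: "q \<in> walks a" "r \<in> walks (n - a)" "z = q ! a" "r ! 0 = q ! a" "Q q" "R r"
      then have len: "length q = Suc a" "r \<noteq> []" by (auto simp: walks_def)
      have "drop a q = [q ! a]" using len Cons_nth_drop_Suc[of a q] by simp
      then have "drop a (q @ tl r) = q ! a # tl r" using len by simp
      also have "\<dots> = r" using len *(4) by (cases r) auto
      finally have "drop a (q @ tl r) = r" .
      moreover have "q @ tl r \<in> walks n" using append_walks[OF *(1,2)] *(4) assms by simp
      ultimately show "q @ tl r \<in> walks n \<and> (q @ tl r) ! a = q ! a \<and>
          Q (take (Suc a) (q @ tl r)) \<and> R (drop a (q @ tl r))"
        using * len by (simp add: nth_append)
    qed
  qed
  then show ?thesis by (simp add: bij_betw_same_card card_cartesian_product)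
qed

text \<open>Two cuts: first at j, then at i inside the initial half.\<close>

lemma card_walks_through:
  assumes "i \<le> j" "j \<le> n"
  shows "real (card {p \<in> walks n. p ! 0 = x \<and> p ! i = z \<and> p ! j = z' \<and> p ! n = y})
    = num_walks i x z * num_walks (j - i) z z' * num_walks (n - j) z' y"
proof -
  have "{p \<in> walks n. p ! 0 = x \<and> p ! i = z \<and> p ! j = z' \<and> p ! n = y}
     = {p \<in> walks n. p ! j = z' \<and> (\<lambda>q. q ! 0 = x \<and> q ! i = z) (take (Suc j) p) \<and> (\<lambda>r. r ! (n - j) = y) (drop j p)}"
    using assms by (auto simp: walks_length)
  then have 1: "card {p \<in> walks n. p ! 0 = x \<and> p ! i = z \<and> p ! j = z' \<and> p ! n = y}
     = card {q \<in> walks j. q ! j = z' \<and> q ! 0 = x \<and> q ! i = z} * card {r \<in> walks (n - j). r ! 0 = z' \<and> r ! (n - j) = y}"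
    using card_walks_cut[OF assms(2), of z' "\<lambda>q. q ! 0 = x \<and> q ! i = z" "\<lambda>r. r ! (n - j) = y"]
    by (simp only:)
  have "{q \<in> walks j. q ! j = z' \<and> q ! 0 = x \<and> q ! i = z}
     = {q \<in> walks j. q ! i = z \<and> (\<lambda>q. q ! 0 = x) (take (Suc i) q) \<and> (\<lambda>r. r ! (j - i) = z') (drop i q)}"
    using assms by (auto simp: walks_length)
  then have 2: "card {q \<in> walks j. q ! j = z' \<and> q ! 0 = x \<and> q ! i = z}
     = card {q \<in> walks i. q ! i = z \<and> q ! 0 = x} * card {r \<in> walks (j - i). r ! 0 = z \<and> r ! (j - i) = z'}"
    using card_walks_cut[OF assms(1), of z "\<lambda>q. q ! 0 = x" "\<lambda>r. r ! (j - i) = z'"]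
    by (simp only:)
  show ?thesis unfolding 1 2 num_walks_def walks_betw_def by (simp add: conj_commute)
qed

text \<open>This is multiplication of powers of the adjacency matrix. It is read off from
  \<open>card_walks_through\<close> with the second intermediate position at the very end of the
  walk.\<close>

lemma num_walks_add:
  "num_walks (a + b) x y = (\<Sum>z\<in>V. num_walks a x z * num_walks b z y)"
proof -
  have "walks_betw (a + b) x y
     = (\<Union>z\<in>V. {p \<in> walks (a + b). p ! 0 = x \<and> p ! a = z \<and> p ! (a + b) = y \<and> p ! (a + b) = y})"
    by (auto simp: walks_betw_def walks_nth_in)
  then have "card (walks_betw (a + b) x y)
     = (\<Sum>z\<in>V. card {p \<in> walks (a + b). p ! 0 = x \<and> p ! a = z \<and> p ! (a + b) = y \<and> p ! (a + b) = y})"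
    using finite_V by (subst card_UN_disjoint[symmetric]) auto
  then have "num_walks (a + b) x y
     = (\<Sum>z\<in>V. num_walks a x z * num_walks (a + b - a) z y * num_walks (a + b - (a + b)) y y)"
    unfolding num_walks_def[of "a + b" x y] of_nat_sum
    by (simp only: card_walks_through le_add1 order_refl of_nat_sum)
  \<comment> \<open>The leftover factor counts walks of length 0, so it is 1 only for y in V; for
    any other y no walk ends there and both sides vanish.\<close>
  moreover have "num_walks a x z * num_walks b z y * num_walks 0 y y = num_walks a x z * num_walks b z y" for z
  proof (cases "y \<in> V")
    case True
    have "walks_betw 0 y y = {[y]}"
      using True by (auto simp: walks_betw_def walks_def length_Suc_conv)
    then show ?thesis by (simp add: num_walks_def)
  next
    case False
    then have "walks_betw b z y = {}" by (auto simp: walks_betw_def walks_nth_in)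
    then show ?thesis by (simp add: num_walks_def)
  qed
  ultimately show ?thesis by simp
qed

lemma num_walks_sym: "num_walks n x y = num_walks n y x"
proof -
  have "bij_betw rev (walks_betw n x y) (walks_betw n y x)"
    by (rule bij_betw_byWitness[where f' = rev])
      (auto simp: walks_betw_def rev_walks rev_nth walks_length)
  then show ?thesis by (simp add: num_walks_def bij_betw_same_card)
qed

lemma num_walks_0: "num_walks 0 x y = (if x = y \<and> x \<in> V then 1 else 0)"
proof -
  have "walks_betw 0 x y = (if x = y \<and> x \<in> V then {[x]} else {})"
    by (auto simp: walks_betw_def walks_def length_Suc_conv)
  then show ?thesis by (auto simp: num_walks_def)
qed

lemma num_walks_1: "num_walks (Suc 0) x y = (if E x y then 1 else 0)"
proof -
  have "walks_betw (Suc 0) x y = (if E x y then {[x, y]} else {})"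
    using E_in E_in2 by (auto simp: walks_betw_def walks_def length_Suc_conv)
  then show ?thesis by (simp add: num_walks_def)
qed

end

section \<open>Closed walks and log-convexity\<close>

text \<open>The ratios f (n + 1) / f n increase with n; the inequality compares those at a and b,
  with denominators cleared.\<close>

lemma log_convex_shift:
  fixes f :: "nat \<Rightarrow> real"
  assumes pos: "\<And>n. f n > 0" and lc: "\<And>n. f (Suc n) ^ 2 \<le> f n * f (Suc (Suc n))"
    and "a \<le> b"
  shows "f (Suc a) * f b \<le> f a * f (Suc b)"
  using assms(3)
proof (induction b rule: dec_induct)
  case base
  then show ?case by (simp add: mult.commute)
next
  case (step b)
  have "f (Suc a) * f (Suc b) * f b \<le> f a * f (Suc b) * f (Suc b)"
    using mult_right_mono[OF step.IH, of "f (Suc b)"] pos[of "Suc b"] by (simp add: algebra_simps)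
  also have "\<dots> \<le> f a * (f b * f (Suc (Suc b)))"
    using mult_left_mono[OF lc[of b], of "f a"] pos[of a] by (simp add: power2_eq_square algebra_simps)
  finally have "f b * (f (Suc a) * f (Suc b)) \<le> f b * (f a * f (Suc (Suc b)))"
    by (simp add: algebra_simps)
  then show ?case using pos[of b] by (simp add: mult_le_cancel_left_pos)
qed

text \<open>Moving two indices apart with their sum fixed can only increase the product; this is
  repeated until the smaller index is 1.\<close>

lemma log_convex_outer:
  fixes f :: "nat \<Rightarrow> real"
  assumes pos: "\<And>n. f n > 0" and lc: "\<And>n. f (Suc n) ^ 2 \<le> f n * f (Suc (Suc n))"
    and "1 \<le> a" "1 \<le> b"
  shows "f a * f b \<le> f 1 * f (a + b - 1)"
proof -
  have *: "a \<le> b \<Longrightarrow> f a * f b \<le> f 1 * f (a + b - 1)" if "1 \<le> a" for a b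
    using that
  proof (induction a arbitrary: b rule: nat_induct_at_least)
    case base
    then show ?case by simp
  next
    case (Suc a)
    have "f (Suc a) * f b \<le> f a * f (Suc b)" using Suc.prems by (intro log_convex_shift pos lc) auto
    also have "\<dots> \<le> f 1 * f (a + Suc b - 1)" using Suc.prems by (intro Suc.IH) auto
    finally show ?case by simp
  qed
  show ?thesis
  proof (cases "a \<le> b")
    case True
    then show ?thesis using *[OF assms(3)] by simp
  next
    case False
    then show ?thesis using *[OF assms(4), of a] by (simp add: mult.commute add.commute)
  qed
qed

context finite_simple
begin

definition closed_at :: "nat \<Rightarrow> 'a \<Rightarrow> real" where
  "closed_at m z = num_walks m z z"

definition total_closed :: "nat \<Rightarrow> real" where
  "total_closed m = (\<Sum>z\<in>V. closed_at m z)"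

lemma closed_nonneg [simp]: "closed_at m z \<ge> 0"
  by (simp add: closed_at_def)

lemma total_closed_nonneg [simp]: "total_closed m \<ge> 0"
  by (simp add: total_closed_def sum_nonneg)

lemma closed_double: "closed_at (2 * j) z = (\<Sum>y\<in>V. (num_walks j z y)\<^sup>2)"
  unfolding closed_at_def mult_2 num_walks_add
  by (rule sum.cong) (simp_all add: num_walks_sym[of j _ z] power2_eq_square)

text \<open>Cauchy-Schwarz for the vectors of a-walks and b-walks starting at z, whose inner product
  counts closed walks of length a + b.\<close>

lemma closed_add_square: "(closed_at (a + b) z)\<^sup>2 \<le> closed_at (2 * a) z * closed_at (2 * b) z"
proof -
  have "closed_at (a + b) z = (\<Sum>y\<in>V. num_walks a z y * num_walks b z y)"
    unfolding closed_at_def num_walks_add by (simp add: num_walks_sym[of b _ z])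
  then show ?thesis
    unfolding closed_double using Cauchy_Schwarz_ineq_sum[of "num_walks a z" "num_walks b z" V] by simp
qed

lemma total_closed_double: "total_closed (2 * j) = (\<Sum>(x, y)\<in>V \<times> V. (num_walks j x y)\<^sup>2)"
  unfolding total_closed_def closed_double sum.cartesian_product ..

lemma total_closed_square:
  "(total_closed (a + b))\<^sup>2 \<le> total_closed (2 * a) * total_closed (2 * b)"
proof -
  have "total_closed (a + b) = (\<Sum>p\<in>V \<times> V. num_walks a (fst p) (snd p) * num_walks b (fst p) (snd p))"
    unfolding total_closed_def closed_at_def num_walks_add sum.cartesian_product
    by (rule sum.cong) (auto simp: num_walks_sym[of b])
  then show ?thesis
    unfolding total_closed_double 
    using Cauchy_Schwarz_ineq_sum[of "\<lambda>p. num_walks a (fst p) (snd p)" "\<lambda>p. num_walks b (fst p) (snd p)" "V \<times> V"]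
    by (simp add: case_prod_beta)
qed

definition nbrs :: "'a \<Rightarrow> 'a set" where
  "nbrs x = {y. E x y}"

lemma nbrs_subset: "nbrs x \<subseteq> V"
  by (auto simp: nbrs_def E_in2)

lemma finite_nbrs [simp]: "finite (nbrs x)"
  using finite_subset[OF nbrs_subset finite_V] .

lemma closed_1: "closed_at 1 z = 0" 
  by (simp add: closed_at_def num_walks_1 E_irrefl)

lemma closed_2: "closed_at 2 z = real (card (nbrs z))"
proof -
  have "closed_at (2 * 1) z = (\<Sum>y\<in>V. if E z y then 1 else 0)"
    unfolding closed_double by (rule sum.cong) (simp_all add: num_walks_1)
  also have "\<dots> = real (card (nbrs z))"
    using nbrs_subset[of z] by (simp add: sum.If_cases finite_V nbrs_def Int_absorb1)
  finally show ?thesis by simp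
qed

text \<open>\<open>closed_add_square\<close> with i and i + 2 bounds the square of the term at i + 1
  by the product of its neighbours, so positivity at i and i + 1 passes to i + 2.\<close>

lemma closed_double_pos:
  assumes "z \<in> V" "nbrs z \<noteq> {}"
  shows "closed_at (2 * j) z > 0"
proof (induction j rule: less_induct)
  case (less j)
  consider "j = 0" | "j = 1" | i where "j = Suc (Suc i)" by (metis One_nat_def not0_implies_Suc)
  then show ?case
  proof cases
    case 1
    then show ?thesis using assms by (simp add: closed_at_def num_walks_0)
  next
    case 2
    then show ?thesis using assms by (simp add: closed_2 card_gt_0_iff)
  next
    case 3
    have "(closed_at (i + j) z)\<^sup>2 \<le> closed_at (2 * i) z * closed_at (2 * j) z" by (rule closed_add_square)
    moreover have "closed_at (i + j) z > 0" using less.IH[of "Suc i"] 3 by (simp add: numeral_2_eq_2)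
    moreover have "closed_at (2 * i) z > 0" using less.IH[of i] 3 by simp
    ultimately show ?thesis
      by (smt (verit) zero_less_power zero_less_mult_iff)
  qed
qed

lemma closed_double_log_convex:
  "(closed_at (2 * Suc n) z)\<^sup>2 \<le> closed_at (2 * n) z * closed_at (2 * Suc (Suc n)) z"
  using closed_add_square[of n "Suc (Suc n)" z] by (simp add: numeral_2_eq_2)

text \<open>For even lengths this is log-convexity of the even-length counts. Odd-length counts may
  vanish, but each is at most the geometric mean of the two neighbouring even ones, which reduces
  the odd case to the even one. Length 1 is separate: one neighbouring index is then 0, below the
  range of \<open>log_convex_outer\<close>, but there are no loops.\<close>

lemma closed_product_le:
  assumes z: "z \<in> V" "nbrs z \<noteq> {}" and ab: "1 \<le> a" "1 \<le> b" "a + b = 2 * k" and k: "k \<ge> 2"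
  shows "closed_at a z * closed_at b z \<le> closed_at 2 z * closed_at (2 * (k - 1)) z"
proof -
  define w where "w j = closed_at (2 * j) z" for j
  have pos: "w j > 0" for j using closed_double_pos[OF z] by (simp add: w_def)
  have outer: "w i * w j \<le> w 1 * w (i + j - 1)" if "1 \<le> i" "1 \<le> j" for i j
    using that pos closed_double_log_convex[of _ z] unfolding w_def by (intro log_convex_outer) auto
  show ?thesis
  proof (cases "even a")
    case True
    then obtain i where i: "a = 2 * i" by (elim evenE)
    then obtain j where j: "b = 2 * j" using ab(3) by (metis dvd_add_right_iff dvd_triv_left evenE)
    have "w i * w j \<le> w 1 * w (i + j - 1)" using i j ab by (intro outer) auto
    moreover have "i + j = k" using i j ab(3) by simp
    ultimately show ?thesis using i j by (simp add: w_def)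
  next
    case False
    then obtain i where i: "a = 2 * i + 1" by (elim oddE)
    moreover have "odd b" using False ab(3) by (metis dvd_add_right_iff dvd_triv_left odd_add)
    then obtain j where j: "b = 2 * j + 1" by (elim oddE)
    have nn: "closed_at 2 z * closed_at (2 * (k - 1)) z \<ge> 0" by simp
    show ?thesis
    proof (cases "i = 0 \<or> j = 0")
      case True
      then show ?thesis using i j nn closed_1[of z] by auto
    next
      case False
      have k': "k = i + j + 1" using i j ab by simp
      have sq: "(closed_at (2 * n + 1) z)\<^sup>2 \<le> w n * w (n + 1)" for n
        using closed_add_square[of n "n + 1" z] by (simp add: w_def mult_2)
      have "(closed_at a z * closed_at b z)\<^sup>2 \<le> (w i * w (i + 1)) * (w j * w (j + 1))"
        unfolding power_mult_distrib i j by (intro mult_mono sq) (use pos in \<open>auto simp: less_imp_le\<close>)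
      \<comment> \<open>The four factors are paired crosswise so that the indices in each pair add
        up to k.\<close>
      also have "\<dots> = (w i * w (j + 1)) * (w (i + 1) * w j)" by simp
      also have "\<dots> \<le> (w 1 * w (k - 1)) * (w 1 * w (k - 1))"
      proof (rule mult_mono)
        show "w i * w (j + 1) \<le> w 1 * w (k - 1)" "w (i + 1) * w j \<le> w 1 * w (k - 1)"
          using outer[of i "j + 1"] outer[of "i + 1" j] False k' by simp_all
      qed (use pos in \<open>auto simp: less_imp_le\<close>)
      also have "\<dots> = (w 1 * w (k - 1))\<^sup>2" by (simp add: power2_eq_square)
      finally have "closed_at a z * closed_at b z \<le> w 1 * w (k - 1)"
        using power2_le_imp_le pos by (meson less_imp_le mult_nonneg_nonneg)
      then show ?thesis by (simp add: w_def)
    qed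
  qed
qed

lemma total_closed_log_convex:
  "(total_closed (2 * Suc n))\<^sup>2 \<le> total_closed (2 * n) * total_closed (2 * Suc (Suc n))"
  using total_closed_square[of n "Suc (Suc n)"] by (simp add: numeral_2_eq_2)

lemma total_closed_0: "total_closed 0 = real (card V)"
  by (simp add: total_closed_def closed_at_def num_walks_0)

end

lemma card_fibres:
  assumes "finite A" "finite B" "f ` A \<subseteq> B"
  shows "card A = (\<Sum>y\<in>B. card {x \<in> A. f x = y})"
proof -
  have "A = (\<Union>y\<in>B. {x \<in> A. f x = y})" using assms(3) by auto
  then have "card A = card (\<Union>y\<in>B. {x \<in> A. f x = y})" by simp
  also have "\<dots> = (\<Sum>y\<in>B. card {x \<in> A. f x = y})"
    using assms by (subst card_UN_disjoint) auto
  finally show ?thesis .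
qed

section \<open>Degenerate closed walks in almost regular graphs\<close>

locale almost_regular = finite_simple +
  fixes d D :: real
  assumes d_pos: "d > 0"
    and deg_ge: "x \<in> V \<Longrightarrow> d \<le> real (card (nbrs x))"
    and deg_le: "x \<in> V \<Longrightarrow> real (card (nbrs x)) \<le> D"
begin

lemma nbrs_nonempty: "x \<in> V \<Longrightarrow> nbrs x \<noteq> {}"
  using deg_ge[of x] d_pos by auto

text \<open>Log-convexity pushes the pair \<open>(a, b)\<close> to the extreme \<open>(2, 2 * k - 2)\<close>, where the first factor is a
  degree; this is what makes degenerate closed walks rare.\<close>

lemma sum_closed_product_le:
  assumes "1 \<le> a" "1 \<le> b" "a + b = 2 * k" "k \<ge> 2"
  shows "(\<Sum>z\<in>V. closed_at a z * closed_at b z) \<le> D * total_closed (2 * (k - 1))"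
proof -
  have "(\<Sum>z\<in>V. closed_at a z * closed_at b z) \<le> (\<Sum>z\<in>V. D * closed_at (2 * (k - 1)) z)"
  proof (rule sum_mono)
    fix z assume z: "z \<in> V"
    have "closed_at a z * closed_at b z \<le> closed_at 2 z * closed_at (2 * (k - 1)) z"
      using closed_product_le[OF z nbrs_nonempty[OF z] assms] .
    also have "\<dots> \<le> D * closed_at (2 * (k - 1)) z"
      using deg_le[OF z] by (intro mult_right_mono) (simp_all add: closed_2)
    finally show "closed_at a z * closed_at b z \<le> D * closed_at (2 * (k - 1)) z" .
  qed
  then show ?thesis by (simp add: total_closed_def sum_distrib_left)
qed

definition closed_walks :: "nat \<Rightarrow> 'a list set" where
  "closed_walks n = {c \<in> walks n. c ! 0 = c ! n}"

lemma finite_closed_walks [simp]: "finite (closed_walks n)"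
  by (simp add: closed_walks_def)

text \<open>A coincidence at z splits the closed walk into two closed walks at z, of lengths j - i
  and 2 k - j + i; the second is formed by the two outer pieces joined at the base point. Requiring
  j - i < 2 k excludes the coincidence of the two ends, which every closed walk has, and makes both
  lengths positive.\<close>

lemma card_closed_walks_coincidence:
  assumes "i < j" "j \<le> 2 * k" "j - i < 2 * k" "k \<ge> 2"
  shows "real (card {c \<in> closed_walks (2 * k). c ! i = c ! j}) \<le> D * total_closed (2 * (k - 1))"
proof -
  let ?A = "{c \<in> closed_walks (2 * k). c ! i = c ! j}"
  have "card ?A = (\<Sum>(x, z)\<in>V \<times> V. card {c \<in> ?A. (c ! 0, c ! i) = (x, z)})"
    unfolding case_prod_beta prod.collapse using finite_V assms(1,2)
    by (intro card_fibres) (auto simp: closed_walks_def walks_nth_in)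
  also have "\<dots> = (\<Sum>(x, z)\<in>V \<times> V. card {c \<in> walks (2 * k). c ! 0 = x \<and> c ! i = z \<and> c ! j = z \<and> c ! (2 * k) = x})"
    by (intro sum.cong refl) (auto simp: closed_walks_def intro!: arg_cong[where f = card])
  finally have "real (card ?A) = (\<Sum>(x, z)\<in>V \<times> V. num_walks i x z * num_walks (j - i) z z * num_walks (2 * k - j) z x)"
    using assms(1,2) by (simp add: card_walks_through case_prod_beta)
  also have "\<dots> = (\<Sum>z\<in>V. \<Sum>x\<in>V. num_walks i x z * num_walks (j - i) z z * num_walks (2 * k - j) z x)"
    unfolding sum.cartesian_product[symmetric] by (rule sum.swap)
  also have "\<dots> = (\<Sum>z\<in>V. closed_at (j - i) z * closed_at (2 * k - j + i) z)"
    unfolding closed_at_def num_walks_add sum_distrib_left by (intro sum.cong refl) (simp add: mult_ac)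
  also have "\<dots> \<le> D * total_closed (2 * (k - 1))"
    using assms by (intro sum_closed_product_le) auto
  finally show ?thesis .
qed

text \<open>For ends v, w the count is the number of half-walks through \<open>Z v w\<close> times
  all half-walks back. Cauchy-Schwarz over (v, w) separates the two; a second one over
  \<open>Z v w\<close> costs the factor m, after which z may range over all of V. The set to avoid
  may depend on the ends because failure of \<open>rich\<close> supplies a different set for each
  pair. Only the square of the count is controlled, which later forces the factor q^2.\<close>

lemma card_closed_walks_hitting:
  assumes "0 < i" "i < k" and Z: "\<And>x y. Z x y \<subseteq> V" "\<And>x y. real (card (Z x y)) \<le> m"
  shows "(real (card {c \<in> closed_walks (2 * k). c ! i \<in> Z (c ! 0) (c ! k)}))\<^sup>2
    \<le> m * D * total_closed (2 * (k - 1)) * total_closed (2 * k)"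
proof -
  let ?A = "{c \<in> closed_walks (2 * k). c ! i \<in> Z (c ! 0) (c ! k)}"
  define S where "S v w = (\<Sum>z\<in>Z v w. num_walks i v z * num_walks (k - i) z w)" for v w
  have fZ: "finite (Z x y)" for x y using Z(1) finite_V finite_subset by blast
  have cp: "(\<Sum>v\<in>V. \<Sum>w\<in>V. g v w) = (\<Sum>p\<in>V \<times> V. g (fst p) (snd p))" for g :: "'a \<Rightarrow> 'a \<Rightarrow> real"
    by (simp add: sum.cartesian_product case_prod_beta)
  have m0: "m \<ge> 0" using Z(2)[of undefined undefined] by linarith
  have "card ?A = (\<Sum>(v, w)\<in>V \<times> V. card {c \<in> ?A. (c ! 0, c ! k) = (v, w)})"
    unfolding case_prod_beta prod.collapse using finite_V
    by (intro card_fibres) (auto simp: closed_walks_def walks_nth_in)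
  also have "\<dots> = (\<Sum>(v, w)\<in>V \<times> V. \<Sum>z\<in>Z v w. card {c \<in> walks (2 * k). c ! 0 = v \<and> c ! i = z \<and> c ! k = w \<and> c ! (2 * k) = v})"
  proof (intro sum.cong refl, clarify)
    fix v w
    have "card {c \<in> ?A. (c ! 0, c ! k) = (v, w)}
       = (\<Sum>z\<in>Z v w. card {c \<in> {c \<in> ?A. (c ! 0, c ! k) = (v, w)}. c ! i = z})"
      using fZ by (intro card_fibres) auto
    also have "\<dots> = (\<Sum>z\<in>Z v w. card {c \<in> walks (2 * k). c ! 0 = v \<and> c ! i = z \<and> c ! k = w \<and> c ! (2 * k) = v})"
      by (intro sum.cong refl arg_cong[where f = card]) (auto simp: closed_walks_def)
    finally show "card {c \<in> ?A. (c ! 0, c ! k) = (v, w)} = \<dots>" .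
  qed
  finally have "real (card ?A) = (\<Sum>(v, w)\<in>V \<times> V. S v w * num_walks k v w)"
    using assms(1,2)
    by (simp add: card_walks_through case_prod_beta S_def sum_distrib_right num_walks_sym[of k])
  then have "(real (card ?A))\<^sup>2 = (\<Sum>p\<in>V \<times> V. S (fst p) (snd p) * num_walks k (fst p) (snd p))\<^sup>2"
    by (simp add: case_prod_beta)
  also have "\<dots> \<le> (\<Sum>p\<in>V \<times> V. (S (fst p) (snd p))\<^sup>2) * (\<Sum>p\<in>V \<times> V. (num_walks k (fst p) (snd p))\<^sup>2)"
    by (rule Cauchy_Schwarz_ineq_sum)
  also have "(\<Sum>p\<in>V \<times> V. (num_walks k (fst p) (snd p))\<^sup>2) = total_closed (2 * k)"
    by (simp add: total_closed_double case_prod_beta)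
  also have "(\<Sum>p\<in>V \<times> V. (S (fst p) (snd p))\<^sup>2) * total_closed (2 * k)
     \<le> (m * (D * total_closed (2 * (k - 1)))) * total_closed (2 * k)"
  proof (rule mult_right_mono)
    have "(\<Sum>p\<in>V \<times> V. (S (fst p) (snd p))\<^sup>2)
       \<le> (\<Sum>p\<in>V \<times> V. m * (\<Sum>z\<in>V. (num_walks i (fst p) z * num_walks (k - i) z (snd p))\<^sup>2))"
    proof (rule sum_mono)
      fix p
      have "(S (fst p) (snd p))\<^sup>2
         \<le> (\<Sum>z\<in>Z (fst p) (snd p). (num_walks i (fst p) z * num_walks (k - i) z (snd p))\<^sup>2) * card (Z (fst p) (snd p))"
        unfolding S_def by (rule sum_squared_le_sum_of_squares)
      \<comment> \<open>The dependence of the range on (v, w) disappears here, so that the sums over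
        v and w factor into closed walks at z.\<close>
      also have "\<dots> \<le> (\<Sum>z\<in>V. (num_walks i (fst p) z * num_walks (k - i) z (snd p))\<^sup>2) * m"
        using Z finite_V by (intro mult_mono sum_mono2) (auto intro: sum_nonneg)
      finally show "(S (fst p) (snd p))\<^sup>2 \<le> m * (\<Sum>z\<in>V. (num_walks i (fst p) z * num_walks (k - i) z (snd p))\<^sup>2)"
        by (simp add: mult.commute)
    qed
    also have "\<dots> = m * (\<Sum>v\<in>V. \<Sum>w\<in>V. \<Sum>z\<in>V. (num_walks i v z)\<^sup>2 * (num_walks (k - i) z w)\<^sup>2)"
      using cp[of "\<lambda>v w. \<Sum>z\<in>V. (num_walks i v z)\<^sup>2 * (num_walks (k - i) z w)\<^sup>2"]
      by (simp add: sum_distrib_left[symmetric] power_mult_distrib)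
    also have "(\<Sum>v\<in>V. \<Sum>w\<in>V. \<Sum>z\<in>V. (num_walks i v z)\<^sup>2 * (num_walks (k - i) z w)\<^sup>2)
       = (\<Sum>v\<in>V. \<Sum>z\<in>V. \<Sum>w\<in>V. (num_walks i z v)\<^sup>2 * (num_walks (k - i) z w)\<^sup>2)"
      by (subst (2) sum.swap) (simp add: num_walks_sym[of i])
    also have "\<dots> = (\<Sum>z\<in>V. \<Sum>v\<in>V. \<Sum>w\<in>V. (num_walks i z v)\<^sup>2 * (num_walks (k - i) z w)\<^sup>2)"
      by (rule sum.swap)
    also have "\<dots> = (\<Sum>z\<in>V. closed_at (2 * i) z * closed_at (2 * (k - i)) z)"
      by (simp add: closed_double sum_product)
    also have "m * \<dots> \<le> m * (D * total_closed (2 * (k - 1)))"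
      using assms m0 by (intro mult_left_mono sum_closed_product_le) auto
    finally show "(\<Sum>p\<in>V \<times> V. (S (fst p) (snd p))\<^sup>2) \<le> m * (D * total_closed (2 * (k - 1)))" .
  qed simp
  finally show ?thesis by (simp add: mult.assoc)
qed

end

section \<open>Embedding and selection\<close>

lemma L_graph_embedding:
  fixes G :: "'a graph" and u :: 'a and v w :: "nat \<Rightarrow> 'a" and x :: "nat \<Rightarrow> nat \<Rightarrow> nat \<Rightarrow> 'a"
  assumes k: "k \<ge> 1" and t: "t \<ge> 1"
    and simple: "simple_graph G"
    and uv: "\<And>i. i < t \<Longrightarrow> {u, v i} \<in> edges G"
    and path: "\<And>i j a. i < t \<Longrightarrow> j \<in> {1..s} \<Longrightarrow> a < k \<Longrightarrow> {x i j a, x i j (Suc a)} \<in> edges G"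
    and ends: "\<And>i j. i < t \<Longrightarrow> j \<in> {1..s} \<Longrightarrow> x i j 0 = v i"
      "\<And>i j. i < t \<Longrightarrow> j \<in> {1..s} \<Longrightarrow> x i j k = w j"
    and inj_v: "inj_on v {..<t}" and inj_w: "inj_on w {1..s}"
    and uw: "\<And>j. j \<in> {1..s} \<Longrightarrow> u \<noteq> w j"
    and vw: "\<And>i j. i < t \<Longrightarrow> j \<in> {1..s} \<Longrightarrow> v i \<noteq> w j"
    and x_root: "\<And>i j a. i < t \<Longrightarrow> j \<in> {1..s} \<Longrightarrow> a \<in> {1..<k} \<Longrightarrow> x i j a \<notin> insert u (v ` {..<t} \<union> w ` {1..s})"
    and x_inj: "\<And>i j a i' j' a'. i < t \<Longrightarrow> j \<in> {1..s} \<Longrightarrow> a \<in> {1..<k} \<Longrightarrow>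
      i' < t \<Longrightarrow> j' \<in> {1..s} \<Longrightarrow> a' \<in> {1..<k} \<Longrightarrow> x i j a = x i' j' a' \<Longrightarrow> i = i' \<and> j = j' \<and> a = a'"
  shows "contains_copy G (L_graph s t k)"
proof -
  \<comment> \<open>Under \<open>Inl\<close> only \<open>LU\<close> and the \<open>LW k j\<close>
    occur in the blowup, so \<open>Inl (LW a j)\<close> can be sent to \<open>w j\<close> without
    inspecting a.\<close>
  define f :: "lvertex + lvertex \<times> nat \<Rightarrow> 'a" where
    "f y = (case y of Inl (LW a j) \<Rightarrow> w j | Inl _ \<Rightarrow> u | Inr (LW a j, i) \<Rightarrow> x i j a | Inr (_, i) \<Rightarrow> v i)" for y
  define h where "h i z = f (blowup_vertex (L1_roots s k) i z)" for i z
  have h_U: "h i LU = u" for i by (simp add: h_def f_def blowup_vertex_def L1_roots_def)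
  have h_V: "h i LV = v i" for i by (simp add: h_def f_def blowup_vertex_def L1_roots_def)
  \<comment> \<open>As x i j k = w j, one formula covers both the root at a = k and the copied
    vertices below it.\<close>
  have h_W: "h i (LW a j) = x i j a" if "i < t" "j \<in> {1..s}" "a \<in> {1..k}" for i j a
    using that ends(2)[of i j] by (auto simp: h_def f_def blowup_vertex_def L1_roots_def)
  have verts: "verts (L_graph s t k) = {Inl LU} \<union> Inl ` LW k ` {1..s} \<union> (\<lambda>i. Inr (LV, i)) ` {..<t}
      \<union> (\<lambda>(i, j, a). Inr (LW a j, i)) ` ({..<t} \<times> {1..s} \<times> {1..<k})" (is "_ = ?vs")
  proof
    show "verts (L_graph s t k) \<subseteq> ?vs"
    proof
      fix y assume "y \<in> verts (L_graph s t k)"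
      then obtain i z where i: "i < t" and z: "z \<in> verts (L1_graph s k)" and y: "y = blowup_vertex (L1_roots s k) i z"
        by (auto simp: L_graph_def rooted_blowup_def)
      show "y \<in> ?vs"
      proof (cases z)
        case LU
        then show ?thesis by (simp add: y blowup_vertex_def L1_roots_def)
      next
        case LV
        then show ?thesis using i by (simp add: y blowup_vertex_def L1_roots_def)
      next
        case (LW a j)
        then have aj: "a \<in> {1..k}" "j \<in> {1..s}" using z by (auto simp: L1_graph_def)
        show ?thesis
        proof (cases "a = k")
          case True
          then have "y = Inl (LW k j)" using LW aj by (simp add: y blowup_vertex_def L1_roots_def)
          then show ?thesis using aj by blast
        next
          case False
          then have "y = (\<lambda>(i, j, a). Inr (LW a j, i)) (i, j, a)" "(i, j, a) \<in> {..<t} \<times> {1..s} \<times> {1..<k}"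
            using LW aj i by (simp_all add: y blowup_vertex_def L1_roots_def)
          then show ?thesis by blast
        qed
      qed
    qed
    show "?vs \<subseteq> verts (L_graph s t k)"
    proof -
      have mem: "blowup_vertex (L1_roots s k) i z \<in> verts (L_graph s t k)" if "i < t" "z \<in> verts (L1_graph s k)" for i z
        using that by (auto simp: L_graph_def rooted_blowup_def)
      have m1: "Inl LU \<in> verts (L_graph s t k)"
        using mem[of 0 LU] t by (simp add: L1_graph_def L1_roots_def blowup_vertex_def)
      have m2: "Inl (LW k j) \<in> verts (L_graph s t k)" if "j \<in> {1..s}" for j
        using mem[of 0 "LW k j"] t k that by (simp add: L1_graph_def L1_roots_def blowup_vertex_def)
      have m3: "Inr (LV, i) \<in> verts (L_graph s t k)" if "i < t" for i
        using mem[of i LV] that by (simp add: L1_graph_def L1_roots_def blowup_vertex_def)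
      have m4: "Inr (LW a j, i) \<in> verts (L_graph s t k)" if "i < t" "j \<in> {1..s}" "a \<in> {1..<k}" for i j a
        using mem[of i "LW a j"] that by (simp add: L1_graph_def L1_roots_def blowup_vertex_def)
      show ?thesis by (auto intro: m1 m2 m3 m4)
    qed
  qed
  have E_h: "f ` e \<in> edges G" if "e \<in> edges (L_graph s t k)" for e
  proof -
    from that obtain i e' where i: "i < t" and e': "e' \<in> edges (L1_graph s k)" "e = blowup_vertex (L1_roots s k) i ` e'"
      by (auto simp: L_graph_def rooted_blowup_def)
    have "f ` e = h i ` e'" using e'(2) by (auto simp: h_def)
    moreover have "h i ` e' \<in> edges G"
      using e'(1) unfolding L1_graph_def
    proof (auto simp: h_U h_V)
      show "{u, v i} \<in> edges G" using uv i .
    next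
      fix j assume j: "Suc 0 \<le> j" "j \<le> s"
      then show "{v i, h i (LW (Suc 0) j)} \<in> edges G"
        using path[of i j 0] ends(1)[of i j] i k by (simp add: h_W)
    next
      fix a j assume "Suc 0 \<le> a" "a \<le> k - Suc 0" "Suc 0 \<le> j" "j \<le> s"
      then show "{h i (LW a j), h i (LW (Suc a) j)} \<in> edges G"
        using path[of i j a] i by (simp add: h_W)
    qed
    ultimately show ?thesis by simp
  qed
  have "u \<noteq> v i" if "i < t" for i
    using uv[OF that] simple by (auto simp: simple_graph_def)
  note uv_ne = this
  have Un: "inj_on f (A \<union> B)" if "inj_on f A" "inj_on f B" "f ` A \<inter> f ` B = {}" for A B
    using that unfolding inj_on_Un by blast
  define A B C where "A = (\<lambda>j. Inl (LW k j) :: lvertex + lvertex \<times> nat) ` {1..s}" and "B = (\<lambda>i. Inr (LV, i) :: lvertex + lvertex \<times> nat) ` {..<t}"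
    and "C = (\<lambda>(i, j, a). Inr (LW a j, i) :: lvertex + lvertex \<times> nat) ` ({..<t} \<times> {1..s} \<times> {1..<k})"
  have fU: "f ` {Inl LU} = {u}" and fA: "f ` A = w ` {1..s}" and fB: "f ` B = v ` {..<t}"
    and fC: "f ` C = (\<lambda>(i, j, a). x i j a) ` ({..<t} \<times> {1..s} \<times> {1..<k})"
    by (simp_all add: f_def A_def B_def C_def image_image case_prod_unfold)
  have C_fresh: "f ` C \<inter> insert u (v ` {..<t} \<union> w ` {1..s}) = {}"
  proof -
    have "y \<notin> insert u (v ` {..<t} \<union> w ` {1..s})" if y: "y \<in> f ` C" for y
    proof -
      obtain i j a where "i < t" "j \<in> {1..s}" "a \<in> {1..<k}" "y = x i j a"
        using y unfolding fC by (auto simp: case_prod_unfold)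
      then show ?thesis using x_root by metis
    qed
    then show ?thesis by blast
  qed
  have "inj_on f A" unfolding A_def using inj_w by (intro inj_on_imageI) (simp add: f_def comp_def)
  moreover have "inj_on f B" unfolding B_def by (rule inj_onI) (auto simp: f_def dest: inj_onD[OF inj_v])
  moreover have "inj_on f C" 
  proof (rule inj_onI)
    have C: "\<exists>i j a. i < t \<and> j \<in> {1..s} \<and> a \<in> {1..<k} \<and> y = Inr (LW a j, i) \<and> f y = x i j a" if "y \<in> C" for y
      using that by (auto simp: C_def f_def)
    fix y z assume "y \<in> C" "z \<in> C" and eq: "f y = f z"
    then obtain i j a i' j' a' where *: "i < t" "j \<in> {1..s}" "a \<in> {1..<k}" "y = Inr (LW a j, i)" "f y = x i j a"
      "i' < t" "j' \<in> {1..s}" "a' \<in> {1..<k}" "z = Inr (LW a' j', i')" "f z = x i' j' a'"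
      using C[of y] C[of z] by blast
    then show "y = z" using x_inj[of i j a i' j' a'] eq by simp
  qed
  ultimately have "inj_on f ({Inl LU} \<union> A \<union> B \<union> C)"
  proof (intro Un)
    show "f ` {Inl LU} \<inter> f ` A = {}" using uw unfolding fU fA by blast
    show "f ` ({Inl LU} \<union> A) \<inter> f ` B = {}" 
    proof -
      have "y \<notin> insert u (w ` {1..s})" if y: "y \<in> v ` {..<t}" for y
      proof -
        obtain i where i: "i < t" "y = v i" using y by (elim imageE) simp
        then show ?thesis using uv_ne[of i] vw[of i] by (metis imageE insertE)
      qed
      then have "insert u (w ` {1..s}) \<inter> v ` {..<t} = {}" by (intro equals0I) (elim IntE, simp only:)
      moreover have "f ` ({Inl LU} \<union> A) = insert u (w ` {1..s})" unfolding image_Un fU fA by simp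
      ultimately show ?thesis by (simp only: fB)
    qed
    show "f ` ({Inl LU} \<union> A \<union> B) \<inter> f ` C = {}"
    proof -
      have "f ` ({Inl LU} \<union> A \<union> B) = insert u (v ` {..<t} \<union> w ` {1..s})"
        unfolding image_Un fU fA fB by (simp add: Un_commute)
      then show ?thesis using C_fresh by (simp only: Int_commute)
    qed
  qed simp
  then have inj: "inj_on f (verts (L_graph s t k))" by (simp add: verts A_def B_def C_def image_image)
  have "f ` verts (L_graph s t k) \<subseteq> verts G"
  proof clarify
    fix y assume "y \<in> verts (L_graph s t k)"
    then obtain i z where iz: "i < t" "z \<in> verts (L1_graph s k)" "y = blowup_vertex (L1_roots s k) i z"
      by (auto simp: L_graph_def rooted_blowup_def)
    have V: "a \<in> verts G" "b \<in> verts G" if "{a, b} \<in> edges G" for a b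
      using that simple by (auto simp: simple_graph_def)
    have "h i z \<in> verts G"
    proof (cases z)
      case LU
      then show ?thesis using V(1)[OF uv[OF iz(1)]] by (simp add: h_U)
    next
      case LV
      then show ?thesis using V(2)[OF uv[OF iz(1)]] by (simp add: h_V)
    next
      case (LW a j)
      then have aj: "a \<in> {1..k}" "j \<in> {1..s}" using iz(2) by (auto simp: L1_graph_def)
      then have "{x i j (a - 1), x i j (Suc (a - 1))} \<in> edges G" using iz(1) by (intro path) auto
      then show ?thesis using V(2) aj iz(1) LW by (simp add: h_W)
    qed
    then show "f y \<in> verts G" by (simp add: h_def iz(3))
  qed
  then show ?thesis using inj E_h unfolding contains_copy_def by blast
qed

text \<open>Greedy: each element chosen earlier rules out at most D candidates. Distinctness is not
  part of the conclusion; it comes from reflexivity of \<open>R\<close> where that holds, as for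
  intersecting spiders.\<close>

lemma conflict_free_choice:
  assumes "finite S" and deg: "\<And>x. x \<in> S \<Longrightarrow> real (card {y \<in> S. R x y}) \<le> D"
    and D: "D \<ge> 0" and "real N * D < real (card S)"
  shows "\<exists>f. (\<forall>a<N. f a \<in> S) \<and> (\<forall>a<N. \<forall>b<a. \<not> R (f b) (f a))"
  using assms(4)
proof (induction N)
  case 0
  then show ?case by simp
next
  case (Suc N)
  have "real N * D < real (card S)" using Suc.prems D by (simp add: algebra_simps)
  then obtain f where f: "\<forall>a<N. f a \<in> S" "\<forall>a<N. \<forall>b<a. \<not> R (f b) (f a)" using Suc.IH by blast
  let ?X = "\<Union>a<N. {y \<in> S. R (f a) y}"
  have "real (card ?X) \<le> (\<Sum>a<N. real (card {y \<in> S. R (f a) y}))"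
    using of_nat_mono[OF card_UN_le[OF finite_lessThan], of "\<lambda>a. {y \<in> S. R (f a) y}" N, where 'a = real] by simp
  also have "\<dots> \<le> (\<Sum>a<N. D)" using f(1) by (intro sum_mono deg) auto
  also have "\<dots> = real N * D" by simp
  also have "\<dots> < real (card S)" by fact
  finally have "card ?X < card S" by simp
  then have "\<not> S \<subseteq> ?X" using card_mono[of ?X S] assms(1) by fastforce
  then obtain y where y: "y \<in> S" "\<forall>a<N. \<not> R (f a) y" by blast
  show ?case
    using f y by (intro exI[of _ "f(N := y)"]) (auto simp: less_Suc_eq)
qed

text \<open>The average degree, counting both directions, is at most 2 |R| / |S|. By Markov's
  inequality at most half of S exceeds twice that, which is \<open>T\<close>, and the greedy choice
  inside the other half needs N T < |S| / 2.\<close>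

lemma sparse_relation_choice:
  assumes fin: "finite S" and sub: "R \<subseteq> S \<times> S" and sparse: "8 * real N * real (card R) < (real (card S))\<^sup>2"
  shows "\<exists>f. (\<forall>a<N. f a \<in> S) \<and> (\<forall>a<N. \<forall>b<N. a \<noteq> b \<longrightarrow> (f a, f b) \<notin> R)"
proof -
  have finR: "finite R" using finite_subset[OF sub] fin by simp
  define deg where "deg x = card {y \<in> S. (x, y) \<in> R \<or> (y, x) \<in> R}" for x
  define T where "T = 4 * real (card R) / real (card S)"
  define S' where "S' = {x \<in> S. real (deg x) \<le> T}"
  have "0 \<le> 8 * real N * real (card R)" by simp
  then have "(real (card S))\<^sup>2 > 0" using sparse by linarith
  then have S0: "card S > 0" by (cases "card S = 0") auto
  have T0: "T \<ge> 0" by (simp add: T_def)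
  have out: "card R = (\<Sum>x\<in>S. card {y \<in> S. (x, y) \<in> R})"
  proof -
    have "card R = (\<Sum>x\<in>S. card {p \<in> R. fst p = x})" using sub finR fin by (intro card_fibres) auto
    also have "\<dots> = (\<Sum>x\<in>S. card {y \<in> S. (x, y) \<in> R})"
      using sub by (intro sum.cong refl bij_betw_same_card[of snd] bij_betw_byWitness[where f' = "Pair _"]) auto
    finally show ?thesis .
  qed
  have inn: "card R = (\<Sum>x\<in>S. card {y \<in> S. (y, x) \<in> R})"
  proof -
    have "card R = (\<Sum>x\<in>S. card {p \<in> R. snd p = x})" using sub finR fin by (intro card_fibres) auto
    also have "\<dots> = (\<Sum>x\<in>S. card {y \<in> S. (y, x) \<in> R})"
      using sub by (intro sum.cong refl bij_betw_same_card[of fst] bij_betw_byWitness[where f' = "\<lambda>y. (y, _)"]) auto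
    finally show ?thesis .
  qed
  have "deg x \<le> card {y \<in> S. (x, y) \<in> R} + card {y \<in> S. (y, x) \<in> R}" for x
    unfolding deg_def by (rule order.trans[OF _ card_Un_le]) (intro card_mono, auto simp: fin)
  then have "(\<Sum>x\<in>S. deg x) \<le> 2 * card R"
    using sum_mono[of S deg "\<lambda>x. card {y \<in> S. (x, y) \<in> R} + card {y \<in> S. (y, x) \<in> R}"] out inn
    by (simp add: sum.distrib)
  then have sumdeg: "(\<Sum>x\<in>S. real (deg x)) \<le> 2 * real (card R)"
    by (metis of_nat_mono of_nat_sum of_nat_mult of_nat_numeral)
  have half: "2 * real (card (S - S')) \<le> real (card S)"
  \<comment> \<open>For empty R the threshold \<open>T\<close> is 0 and the Markov argument cannot
    divide by it.\<close>
  proof (cases "card R = 0")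
    case True
    then have "S - S' = {}" using finR by (auto simp: S'_def T_def deg_def)
    then have "card (S - S') = 0" by (simp only: card.empty)
    then show ?thesis by simp
  next
    case False
    have "T * real (card (S - S')) = (\<Sum>x\<in>S - S'. T)" by simp
    also have "\<dots> \<le> (\<Sum>x\<in>S - S'. real (deg x))" by (rule sum_mono) (auto simp: S'_def)
    also have "\<dots> \<le> (\<Sum>x\<in>S. real (deg x))" using fin by (intro sum_mono2) auto
    also have "\<dots> \<le> 2 * real (card R)" by (rule sumdeg)
    finally show ?thesis using False S0 by (simp add: T_def field_simps)
  qed
  have cS': "real (card S') \<ge> real (card S) / 2"
  proof -
    have "card (S - S') = card S - card S'" "card S' \<le> card S"
      using fin by (auto simp: S'_def card_Diff_subset intro: card_mono)
    then show ?thesis using half by simp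
  qed
  have "\<exists>f. (\<forall>a<N. f a \<in> S') \<and> (\<forall>a<N. \<forall>b<a. \<not> ((f b, f a) \<in> R \<or> (f a, f b) \<in> R))"
  proof (rule conflict_free_choice[where D = T])
    show "finite S'" using fin by (simp add: S'_def)
    show "real (card {y \<in> S'. (x, y) \<in> R \<or> (y, x) \<in> R}) \<le> T" if "x \<in> S'" for x
    proof -
      have "card {y \<in> S'. (x, y) \<in> R \<or> (y, x) \<in> R} \<le> deg x"
        unfolding deg_def using fin by (intro card_mono) (auto simp: S'_def)
      then show ?thesis using that by (simp add: S'_def)
    qed
    have "real N * T < real (card S) / 2"
      using sparse S0 by (simp add: T_def field_simps power2_eq_square)
    then show "real N * T < real (card S')" using cS' by linarith
  qed (rule T0)
  then obtain f where "\<forall>a<N. f a \<in> S'" and f: "\<forall>a<N. \<forall>b<a. (f b, f a) \<notin> R \<and> (f a, f b) \<notin> R" by blast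
  then have "\<forall>a<N. f a \<in> S" by (simp add: S'_def)
  moreover have "\<forall>a<N. \<forall>b<N. a \<noteq> b \<longrightarrow> (f a, f b) \<notin> R" using f by (metis nat_neq_iff)
  ultimately show ?thesis by blast
qed

context finite_simple
begin

text \<open>Connecting several rich pairs one after the other, the vertices used so far are the set \<open>Z\<close> to avoid.\<close>

definition rich :: "nat \<Rightarrow> nat \<Rightarrow> 'a \<Rightarrow> 'a \<Rightarrow> bool" where
  "rich k m v w \<longleftrightarrow> (\<forall>Z. finite Z \<and> card Z \<le> m \<longrightarrow>
     (\<exists>p\<in>walks_betw k v w. distinct p \<and> (\<forall>i\<in>{1..<k}. p ! i \<notin> Z)))"

lemma rich_disjoint_paths:
  assumes "finite I" "finite F" "card F + card I * (k - 1) \<le> m" "\<And>i. i \<in> I \<Longrightarrow> rich k m (v i) (w i)"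
  shows "\<exists>p. \<forall>i\<in>I. p i \<in> walks_betw k (v i) (w i) \<and> distinct (p i) \<and>
    (\<forall>a\<in>{1..<k}. p i ! a \<notin> F \<and> (\<forall>j\<in>I. \<forall>b\<in>{1..<k}. p i ! a = p j ! b \<longrightarrow> i = j \<and> a = b))"
  using assms(1,3,4)
proof (induction I rule: finite_induct)
  case empty
  then show ?case by simp
next
  case (insert i I)
  have "card F + card I * (k - 1) \<le> m" using insert.prems(1) insert.hyps by simp
  then obtain p where p: "\<forall>i\<in>I. p i \<in> walks_betw k (v i) (w i) \<and> distinct (p i) \<and>
    (\<forall>a\<in>{1..<k}. p i ! a \<notin> F \<and> (\<forall>j\<in>I. \<forall>b\<in>{1..<k}. p i ! a = p j ! b \<longrightarrow> i = j \<and> a = b))"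
    using insert.IH insert.prems(2) by (metis insertCI)
  define Z where "Z = F \<union> (\<lambda>(j, b). p j ! b) ` (I \<times> {1..<k})"
  have "card Z \<le> card F + card (I \<times> {1..<k})"
    unfolding Z_def using insert.hyps by (intro order.trans[OF card_Un_le] add_left_mono card_image_le) auto
  also have "\<dots> \<le> m" using insert.prems(1) insert.hyps by (simp add: card_cartesian_product)
  finally have "card Z \<le> m" .
  moreover have "finite Z" using insert.hyps assms(2) by (simp add: Z_def)
  moreover have "rich k m (v i) (w i)" using insert.prems by simp
  ultimately obtain q where q: "q \<in> walks_betw k (v i) (w i)" "distinct q" "\<forall>a\<in>{1..<k}. q ! a \<notin> Z"
    unfolding rich_def by blast
  have "p j ! b \<in> Z" if "j \<in> I" "b \<in> {1..<k}" for j b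
    unfolding Z_def by (intro UnI2 image_eqI[of _ _ "(j, b)"]) (use that in auto)
  then have qp: "q ! a \<noteq> p j ! b" if "a \<in> {1..<k}" "j \<in> I" "b \<in> {1..<k}" for a j b
    using q(3) that by metis
  have qF: "q ! a \<notin> F" if "a \<in> {1..<k}" for a
    using q(3) that unfolding Z_def by blast
  have qq: "a = b" if "q ! a = q ! b" "a \<in> {1..<k}" "b \<in> {1..<k}" for a b
    using that q(1,2) by (subst (asm) nth_eq_iff_index_eq) (auto simp: walks_betw_def walks_length)
  have qp': "p j ! b \<noteq> q ! a" if "a \<in> {1..<k}" "j \<in> I" "b \<in> {1..<k}" for a j b
    using qp[OF that] by metis
  show ?case
    using p q(1,2) qF qp qp' qq insert.hyps(2) by (intro exI[of _ "p(i := q)"]) (auto 4 4)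
qed

end

section \<open>Many closed walks\<close>

context almost_regular
begin

definition bad_closed_walks :: "nat \<Rightarrow> nat \<Rightarrow> 'a list set" where
  "bad_closed_walks k m = {c \<in> closed_walks (2 * k).
     (\<exists>i j. i < j \<and> j \<le> 2 * k \<and> j - i < 2 * k \<and> c ! i = c ! j) \<or> \<not> rich k m (c ! 0) (c ! k)}"

text \<open>A union bound over fewer than (2 k + 1)^2 + k events, each of size at most
  \<open>total_closed (2 * k) / q\<close>. Coincidences would need only the factor q in
  \<open>heavy\<close>; the factor m q^2 is what the bound on the squared number of hitting walks
  requires.\<close>

lemma card_bad_closed_walks:
  assumes k: "k \<ge> 2" and m: "m \<ge> 1" and q: "q \<ge> 1"
    and heavy: "real m * q\<^sup>2 * D * total_closed (2 * (k - 1)) \<le> total_closed (2 * k)"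
  shows "real (card (bad_closed_walks k m)) \<le> real ((2 * k + 1)\<^sup>2 + k) / q * total_closed (2 * k)"
proof -
  let ?T = "total_closed (2 * k)" and ?T' = "total_closed (2 * (k - 1))"
  \<comment> \<open>One blocking set is fixed for each pair that is not rich. Cutting it down to V
    loses nothing, since walks stay in V.\<close>
  have "\<exists>Z. Z \<subseteq> V \<and> card Z \<le> m \<and> (\<not> rich k m v w \<longrightarrow>
      (\<forall>p\<in>walks_betw k v w. distinct p \<longrightarrow> (\<exists>i\<in>{1..<k}. p ! i \<in> Z)))" for v w
  proof (cases "rich k m v w")
    case True
    then show ?thesis by (intro exI[of _ "{}"]) simp
  next
    case False
    then obtain Z where Z: "finite Z" "card Z \<le> m" 
      "\<not> (\<exists>p\<in>walks_betw k v w. distinct p \<and> (\<forall>i\<in>{1..<k}. p ! i \<notin> Z))"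
      by (simp only: rich_def not_all not_imp) (elim exE conjE)
    have cZ: "card (Z \<inter> V) \<le> m" using Z(1,2) card_mono[of Z "Z \<inter> V"] by simp
    have hit: "\<exists>i\<in>{1..<k}. p ! i \<in> Z \<inter> V" if p: "p \<in> walks_betw k v w" "distinct p" for p
    proof -
      obtain i where "i \<in> {1..<k}" "p ! i \<in> Z" using Z(3) p by metis
      moreover have "p ! i \<in> V" using p(1) \<open>i \<in> {1..<k}\<close> by (auto simp: walks_betw_def intro: walks_nth_in)
      ultimately show ?thesis by blast
    qed
    show ?thesis by (intro exI[of _ "Z \<inter> V"] conjI impI ballI cZ hit) simp_all
  qed
  then obtain Z where ZV: "\<And>v w. Z v w \<subseteq> V" and Zm: "\<And>v w. card (Z v w) \<le> m"
    and Z: "\<And>v w p. \<not> rich k m v w \<Longrightarrow> p \<in> walks_betw k v w \<Longrightarrow> distinct p \<Longrightarrow> \<exists>i\<in>{1..<k}. p ! i \<in> Z v w"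
    by metis
  define I where "I = {(i, j). i < j \<and> j \<le> 2 * k \<and> j - i < 2 * k}"
  have I: "I \<subseteq> {..2 * k} \<times> {..2 * k}" by (auto simp: I_def)
  then have finI: "finite I" using finite_subset by blast
  have cardI: "card I \<le> (2 * k + 1)\<^sup>2"
    using card_mono[OF _ I] by (simp add: card_cartesian_product power2_eq_square)
  define X where "X i j = {c \<in> closed_walks (2 * k). c ! i = c ! j}" for i j
  define Y where "Y i = {c \<in> closed_walks (2 * k). c ! i \<in> Z (c ! 0) (c ! k)}" for i
  have "bad_closed_walks k m \<subseteq> (\<Union>(i, j)\<in>I. X i j) \<union> (\<Union>i\<in>{1..<k}. Y i)"
  proof
    fix c assume c: "c \<in> bad_closed_walks k m"
    show "c \<in> (\<Union>(i, j)\<in>I. X i j) \<union> (\<Union>i\<in>{1..<k}. Y i)"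
    proof (cases "\<exists>i j. i < j \<and> j \<le> 2 * k \<and> j - i < 2 * k \<and> c ! i = c ! j")
      case True
      then obtain i j where "(i, j) \<in> I" "c ! i = c ! j" unfolding I_def by blast
      then have "c \<in> X i j" using c by (simp add: X_def bad_closed_walks_def)
      then show ?thesis using \<open>(i, j) \<in> I\<close> by blast
    next
      case False
      have cw: "c \<in> closed_walks (2 * k)" and nr: "\<not> rich k m (c ! 0) (c ! k)"
        using c False by (auto simp: bad_closed_walks_def)
      have ck: "c \<in> walks (2 * k)" using cw by (simp add: closed_walks_def)
      \<comment> \<open>Equal entries of this first half would be a coincidence at distance at most
        k < 2 k. So the half is a path, and the blocking set of its ends must meet its
        interior.\<close>
      let ?p = "take (Suc k) c"
      have "?p \<in> walks_betw k (c ! 0) (c ! k)"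
        using ck take_walks[OF ck, of k] by (simp add: walks_betw_def)
      moreover have "distinct ?p"
      proof -
        have "?p ! i \<noteq> ?p ! j" if "i < j" "j < length ?p" for i j
        proof -
          have "j \<le> k" using that ck by (simp add: walks_length)
          then show ?thesis using False that(1) k by auto
        qed
        then show ?thesis unfolding distinct_conv_nth by (metis nat_neq_iff)
      qed
      ultimately obtain i where i: "i \<in> {1..<k}" "?p ! i \<in> Z (c ! 0) (c ! k)" using Z[OF nr] by blast
      then have "c \<in> Y i" using cw by (simp add: Y_def)
      then show ?thesis using i(1) by blast
    qed
  qed
  then have "card (bad_closed_walks k m) \<le> card ((\<Union>(i, j)\<in>I. X i j) \<union> (\<Union>i\<in>{1..<k}. Y i))"
    using finI by (intro card_mono) (auto simp: X_def Y_def)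
  also have "\<dots> \<le> card (\<Union>(i, j)\<in>I. X i j) + card (\<Union>i\<in>{1..<k}. Y i)" by (rule card_Un_le)
  also have "\<dots> \<le> (\<Sum>(i, j)\<in>I. card (X i j)) + (\<Sum>i\<in>{1..<k}. card (Y i))"
    using card_UN_le[OF finI, of "\<lambda>(i, j). X i j"] card_UN_le[of "{1..<k}" Y]
    by (simp add: case_prod_beta)
  finally have "real (card (bad_closed_walks k m)) \<le> (\<Sum>ij\<in>I. real (card (X (fst ij) (snd ij)))) + (\<Sum>i\<in>{1..<k}. real (card (Y i)))"
    by (simp add: case_prod_beta flip: of_nat_sum of_nat_add)
  also have "\<dots> \<le> (\<Sum>ij\<in>I. ?T / q) + (\<Sum>i\<in>{1..<k}. ?T / q)"
  proof (intro add_mono sum_mono)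
    have D0: "D * ?T' \<ge> 0"
    proof (cases "V = {}")
      case True
      then have "?T' = 0" unfolding total_closed_def by (simp only: sum.empty)
      then show ?thesis by simp
    next
      case False
      then obtain x where "x \<in> V" by blast
      then have "D \<ge> 0" using deg_le[of x] by linarith
      then show ?thesis by simp
    qed
    have mq: "real m * q\<^sup>2 \<ge> q"
    proof -
      have "1 * q * 1 \<le> real m * q * q" using m q by (intro mult_mono) auto
      then show ?thesis by (simp add: power2_eq_square)
    qed
    fix ij assume "ij \<in> I"
    then have "real (card (X (fst ij) (snd ij))) \<le> D * ?T'"
      unfolding X_def I_def using k by (intro card_closed_walks_coincidence) auto
    moreover have "q * (D * ?T') \<le> real m * q\<^sup>2 * (D * ?T')" using mq D0 by (intro mult_right_mono)
    ultimately show "real (card (X (fst ij) (snd ij))) \<le> ?T / q"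
      using heavy q by (simp add: pos_le_divide_eq mult.assoc) (smt (verit) mult.commute mult_left_mono)
  next
    fix i assume "i \<in> {1..<k}"
    then have "(real (card (Y i)))\<^sup>2 \<le> real m * D * ?T' * ?T"
      unfolding Y_def using ZV Zm by (intro card_closed_walks_hitting) auto
    then have "(q * real (card (Y i)))\<^sup>2 \<le> q\<^sup>2 * (real m * D * ?T' * ?T)"
      by (simp add: power_mult_distrib mult_left_mono)
    also have "\<dots> = (real m * q\<^sup>2 * D * ?T') * ?T" by simp
    also have "\<dots> \<le> ?T * ?T" by (intro mult_right_mono heavy) simp
    finally have "(q * real (card (Y i)))\<^sup>2 \<le> ?T\<^sup>2" by (simp only: power2_eq_square)
    then have "q * real (card (Y i)) \<le> ?T" by (rule power2_le_imp_le) simp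
    then show "real (card (Y i)) \<le> ?T / q" using q by (simp add: pos_le_divide_eq mult.commute)
  qed
  also have "\<dots> = real (card I + (k - 1)) * (?T / q)" by (simp add: distrib_right add_divide_distrib)
  also have "\<dots> \<le> real ((2 * k + 1)\<^sup>2 + k) * (?T / q)"
  proof (intro mult_right_mono of_nat_mono)
    show "card I + (k - 1) \<le> (2 * k + 1)\<^sup>2 + k" using cardI by linarith
    show "0 \<le> ?T / q" using q by simp
  qed
  finally show ?thesis by (simp only: times_divide_eq_right times_divide_eq_left)
qed

text \<open>For walks \<open>p\<close> and \<open>r\<close> of length \<open>k\<close> with common ends \<open>u\<close> and \<open>y\<close>, the closed walk \<open>join_walks p r\<close>
  runs along \<open>p\<close> and back along \<open>r\<close>, but starts at \<open>p ! 1\<close>, so that its antipodal positions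
  \<open>0\<close> and \<open>k\<close> hold \<open>p ! 1\<close> and \<open>r ! (k - 1)\<close>, the future \<open>v\<close> and \<open>w\<close> vertices.\<close>

definition join_walks :: "'a list \<Rightarrow> 'a list \<Rightarrow> 'a list" where
  "join_walks p r = (tl p @ tl (rev r)) @ tl [r ! 0, p ! 1]"

lemma join_walks_nth:
  assumes "length p = Suc k" "length r = Suc k" "k \<ge> 1"
  shows "a < k \<Longrightarrow> join_walks p r ! a = p ! Suc a"
    and "b < k \<Longrightarrow> join_walks p r ! (k + b) = r ! (k - 1 - b)"
    and "join_walks p r ! (2 * k) = p ! 1"
  using assms by (auto simp: join_walks_def nth_append nth_tl rev_nth)

lemma join_walks_closed:
  assumes p: "p \<in> walks k" and r: "r \<in> walks k" and "p ! 0 = r ! 0" "p ! k = r ! k" and k: "k \<ge> 1"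
  shows "join_walks p r \<in> closed_walks (2 * k)"
proof -
  have len: "length p = Suc k" "length r = Suc k" using p r by (auto simp: walks_length)
  have tp: "tl p \<in> walks (k - 1)" using drop_walks[OF p, of 1] k by (simp add: drop_Suc)
  have "tl p @ tl (rev r) \<in> walks (k - 1 + k)"
    using len k assms(4) by (intro append_walks tp rev_walks r) (simp add: nth_tl rev_nth)
  moreover have "[r ! 0, p ! 1] \<in> walks 1"
    using walks_adj[OF p, of 0] walks_nth_in[OF p, of 1] walks_nth_in[OF r, of 0] k assms(3)
    by (simp add: walks_def)
  moreover have "(tl p @ tl (rev r)) ! (k - 1 + k) = [r ! 0, p ! 1] ! 0"
    using join_walks_nth(2)[OF len k, of "k - 1"] len k by (auto simp: nth_append nth_tl rev_nth)
  ultimately have "join_walks p r \<in> walks (k - 1 + k + 1)"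
    unfolding join_walks_def by (rule append_walks)
  moreover have "k - 1 + k + 1 = 2 * k" using k by simp
  ultimately have "join_walks p r \<in> walks (2 * k)" by (simp only:)
  then show ?thesis
    using join_walks_nth(1)[OF len k, of 0] join_walks_nth(3)[OF len k] k by (simp add: closed_walks_def)
qed

text \<open>\<open>tl p\<close> drops the start of p and \<open>tl (rev r)\<close> drops the end of
  r, but both are recovered from the other walk because the ends are common.\<close>

lemma join_walks_inj:
  assumes "p \<in> walks k" "r \<in> walks k" "p ! 0 = r ! 0" "p ! k = r ! k" 
    "p' \<in> walks k" "r' \<in> walks k" "p' ! 0 = r' ! 0" "p' ! k = r' ! k" and k: "k \<ge> 1"
    and eq: "join_walks p r = join_walks p' r'"
  shows "p = p' \<and> r = r'"
proof -
  have len: "length p = Suc k" "length r = Suc k" "length p' = Suc k" "length r' = Suc k"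
    using assms by (auto simp: walks_length)
  have P: "p ! Suc a = p' ! Suc a" if "a < k" for a
    using join_walks_nth(1)[OF len(1,2) k that] join_walks_nth(1)[OF len(3,4) k that] eq by simp
  have R: "r ! b = r' ! b" if "b < k" for b
    using join_walks_nth(2)[OF len(1,2) k, of "k - 1 - b"] join_walks_nth(2)[OF len(3,4) k, of "k - 1 - b"] eq that by simp
  have "p = p'"
  proof (rule nth_equalityI)
    fix i assume i: "i < length p"
    show "p ! i = p' ! i"
    proof (cases i)
      case 0
      then show ?thesis using R[of 0] k assms(3,7) by simp
    next
      case (Suc a)
      then show ?thesis using P[of a] i len by simp
    qed
  qed (simp add: len)
  moreover have "r = r'"
  proof (rule nth_equalityI)
    fix i assume i: "i < length r"
    then consider "i < k" | "i = k" using len by linarith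
    then show "r ! i = r' ! i" using R assms(4,8) \<open>p = p'\<close> by cases auto
  qed (simp add: len)
  ultimately show ?thesis ..
qed

text \<open>Averaging over (u, y): the squares on the right add up to
  \<open>total_closed (2 * k)\<close>, while the bad pairs for all (u, y) together inject into the
  bad closed walks.\<close>

lemma sparse_bad_pairs:
  assumes k: "k \<ge> 1" and M: "M * real (card (bad_closed_walks k m)) < total_closed (2 * k)" "M \<ge> 0"
  shows "\<exists>u y. M * real (card {(p, r). p \<in> walks_betw k u y \<and> r \<in> walks_betw k u y \<and> join_walks p r \<in> bad_closed_walks k m})
    < (real (card (walks_betw k u y)))\<^sup>2"
proof (rule ccontr)
  define R where "R uy = {(p, r). p \<in> walks_betw k (fst uy) (snd uy) \<and> r \<in> walks_betw k (fst uy) (snd uy) \<and> join_walks p r \<in> bad_closed_walks k m}" for uy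
  assume "\<not> ?thesis"
  then have ge: "(num_walks k (fst uy) (snd uy))\<^sup>2 \<le> M * real (card (R uy))" for uy
    unfolding R_def num_walks_def by (simp add: not_less)
  have finR: "finite (R uy)" for uy
    by (rule finite_subset[of _ "walks_betw k (fst uy) (snd uy) \<times> walks_betw k (fst uy) (snd uy)"]) (auto simp: R_def)
  have "total_closed (2 * k) = (\<Sum>uy\<in>V \<times> V. (num_walks k (fst uy) (snd uy))\<^sup>2)"
    by (simp add: total_closed_double case_prod_beta)
  also have "\<dots> \<le> (\<Sum>uy\<in>V \<times> V. M * real (card (R uy)))" by (intro sum_mono ge)
  also have "\<dots> = M * real (\<Sum>uy\<in>V \<times> V. card (R uy))" by (simp add: sum_distrib_left)
  also have "(\<Sum>uy\<in>V \<times> V. card (R uy)) = card (\<Union>uy\<in>V \<times> V. R uy)"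
    using finite_V finR by (subst card_UN_disjoint) (auto simp: R_def walks_betw_def)
  also have "\<dots> \<le> card (bad_closed_walks k m)"
  proof (rule card_inj_on_le[where f = "\<lambda>(p, r). join_walks p r"])
    show "inj_on (\<lambda>(p, r). join_walks p r) (\<Union>uy\<in>V \<times> V. R uy)"
    proof (rule inj_onI, clarify)
      fix p r p' r' u y u' y'
      assume "(p, r) \<in> R (u, y)" "(p', r') \<in> R (u', y')" "join_walks p r = join_walks p' r'"
      then show "p = p' \<and> r = r'" using k by (intro join_walks_inj) (auto simp: R_def walks_betw_def)
    qed
    show "(\<lambda>(p, r). join_walks p r) ` (\<Union>uy\<in>V \<times> V. R uy) \<subseteq> bad_closed_walks k m" by (auto simp: R_def)
    show "finite (bad_closed_walks k m)" by (simp add: bad_closed_walks_def)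
  qed
  finally show False using M by (simp add: mult_left_mono)
qed

lemma total_closed_pos: "V \<noteq> {} \<Longrightarrow> total_closed (2 * k) > 0"
  unfolding total_closed_def using finite_V
  by (intro sum_pos closed_double_pos nbrs_nonempty) auto

text \<open>These are the demands that a copy of \<open>L_graph\<close> makes on two parallel walks.
  In the joined walk, p ! 1, p ! (k - 1), r ! (k - 1), r ! 1 and u stand at positions 0, k - 2, k, 2
  k - 2 and 2 k - 1, so each violated inequality would be a coincidence.\<close>

lemma not_bad_join:
  assumes p: "p \<in> walks_betw k u y" and r: "r \<in> walks_betw k u y" and k: "k \<ge> 2"
    and good: "join_walks p r \<notin> bad_closed_walks k m"
  shows "rich k m (p ! 1) (r ! (k - 1))" "p ! 1 \<noteq> r ! 1" "p ! (k - 1) \<noteq> r ! (k - 1)"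
    "p ! 1 \<noteq> r ! (k - 1)" "u \<noteq> r ! (k - 1)"
proof -
  let ?c = "join_walks p r"
  have pr: "p \<in> walks k" "r \<in> walks k" "p ! 0 = u" "r ! 0 = u" "p ! k = y" "r ! k = y"
    using p r by (auto simp: walks_betw_def)
  have len: "length p = Suc k" "length r = Suc k" using pr by (auto simp: walks_length)
  have k1: "k \<ge> 1" using k by simp
  have closed: "?c \<in> closed_walks (2 * k)" using pr k by (intro join_walks_closed) auto
  have ne: "?c ! i \<noteq> ?c ! j" if "i < j" "j < 2 * k" for i j
    using good closed that unfolding bad_closed_walks_def by auto
  have c0: "?c ! 0 = p ! 1" using join_walks_nth(1)[OF len k1, of 0] k by simp
  have ck: "?c ! k = r ! (k - 1)" using join_walks_nth(2)[OF len k1, of 0] k by simp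
  have c1: "?c ! (k - 2) = p ! (k - 1)"
  proof -
    have "Suc (k - 2) = k - 1" using k by simp
    then show ?thesis using join_walks_nth(1)[OF len k1, of "k - 2"] k by (simp only:)
  qed
  have cr: "?c ! (k + (k - 2)) = r ! 1"
    using join_walks_nth(2)[OF len k1, of "k - 2"] k by (simp add: Suc_diff_le numeral_2_eq_2)
  have cu: "?c ! (k + (k - 1)) = u" using join_walks_nth(2)[OF len k1, of "k - 1"] k pr by simp
  show "rich k m (p ! 1) (r ! (k - 1))"
    using good closed c0 ck unfolding bad_closed_walks_def by auto
  show "p ! 1 \<noteq> r ! 1" using ne[of 0 "k + (k - 2)"] k unfolding c0 cr by simp
  show "p ! (k - 1) \<noteq> r ! (k - 1)" using ne[of "k - 2" k] k unfolding c1 ck by simp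
  show "p ! 1 \<noteq> r ! (k - 1)" using ne[of 0 k] k unfolding c0 ck by simp
  show "u \<noteq> r ! (k - 1)" using ne[of k "k + (k - 1)"] k unfolding cu ck by force
qed

text \<open>m is the number of vertices of \<open>L_graph s t k\<close>, so a rich pair can be
  connected around any part of the copy already built. q makes the proportion of bad closed walks
  smaller than 1 / (8 (t + s)), the threshold of \<open>sparse_relation_choice\<close> for t + s
  walks.\<close>

lemma contains_copy_if_many_closed_walks:
  fixes G :: "'a graph" and s t k :: nat
  defines "m \<equiv> 1 + t + s + t * s * (k - 1)"
    and "q \<equiv> 8 * real (t + s) * real ((2 * k + 1)\<^sup>2 + k) + 1"
  assumes G: "simple_graph G" and E_G: "\<And>x y. E x y \<Longrightarrow> {x, y} \<in> edges G"
    and k: "k \<ge> 2" and t: "t \<ge> 1" and V: "V \<noteq> {}"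
    and heavy: "real m * q\<^sup>2 * D * total_closed (2 * (k - 1)) \<le> total_closed (2 * k)"
  shows "contains_copy G (L_graph s t k)"
proof -
  let ?T = "total_closed (2 * k)" and ?c = "real ((2 * k + 1)\<^sup>2 + k)"
  have T: "?T > 0" using total_closed_pos[OF V] .
  have q1: "q \<ge> 1" by (simp add: q_def)
  have "8 * real (t + s) * real (card (bad_closed_walks k m)) \<le> 8 * real (t + s) * (?c / q * ?T)"
    using card_bad_closed_walks[OF k _ q1 heavy] by (intro mult_left_mono) (auto simp: m_def)
  also have "\<dots> = (8 * real (t + s) * ?c) / q * ?T" by simp
  also have "\<dots> < 1 * ?T"
  proof (rule mult_strict_right_mono)
    have "8 * real (t + s) * ?c < q" by (simp add: q_def)
    then show "8 * real (t + s) * ?c / q < 1" using q1 by (subst divide_less_eq_1_pos) linarith+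
  qed (rule T)
  finally have "8 * real (t + s) * real (card (bad_closed_walks k m)) < ?T" by simp
  \<comment> \<open>Of the two common ends only u becomes a designated vertex of the copy; y just
    makes the walks parallel.\<close>
  then obtain u y where uy: "8 * real (t + s) * real (card {(p, r). p \<in> walks_betw k u y \<and> r \<in> walks_betw k u y \<and> join_walks p r \<in> bad_closed_walks k m})
    < (real (card (walks_betw k u y)))\<^sup>2"
    using sparse_bad_pairs[of k "8 * real (t + s)" m] k by auto
  \<comment> \<open>A walk joined with itself is bad, because its vertex p ! 1 occurs at positions 0
    and 2 k - 2. Hence the chosen walks are automatically distinct.\<close>
  have "\<exists>f. (\<forall>a<t + s. f a \<in> walks_betw k u y) \<and> (\<forall>a<t + s. \<forall>b<t + s. a \<noteq> b \<longrightarrow>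
     (f a, f b) \<notin> {(p, r). p \<in> walks_betw k u y \<and> r \<in> walks_betw k u y \<and> join_walks p r \<in> bad_closed_walks k m})"
    by (rule sparse_relation_choice[OF _ _ uy]) auto
  then obtain f where f0: "\<forall>a<t + s. f a \<in> walks_betw k u y" and good0: "\<forall>a<t + s. \<forall>b<t + s. a \<noteq> b \<longrightarrow>
     (f a, f b) \<notin> {(p, r). p \<in> walks_betw k u y \<and> r \<in> walks_betw k u y \<and> join_walks p r \<in> bad_closed_walks k m}"
    by (elim exE conjE)
  have f: "f a \<in> walks_betw k u y" if "a < t + s" for a using f0 that by simp
  have good: "join_walks (f a) (f b) \<notin> bad_closed_walks k m" if "a < t + s" "b < t + s" "a \<noteq> b" for a b
    using good0 f that by simp
  define v where "v i = f i ! 1" for i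
  define w where "w j = f (t + (j - 1)) ! (k - 1)" for j
  note nb = not_bad_join[OF f f k good]
  have uv: "E u (v i)" if "i < t" for i
    using f[of i] that k walks_adj[of "f i" k 0] by (auto simp: v_def walks_betw_def)
  have rich: "rich k m (v i) (w j)" and vw: "v i \<noteq> w j" and uw: "u \<noteq> w j"
    if "i < t" "j \<in> {1..s}" for i j
  proof -
    have ij: "i < t + s" "t + (j - 1) < t + s" "i \<noteq> t + (j - 1)" using that by auto
    show "rich k m (v i) (w j)" "v i \<noteq> w j" "u \<noteq> w j"
      unfolding v_def w_def using nb(1,4,5)[OF ij(1,2) ij] by simp_all
  qed
  have uw: "u \<noteq> w j" if "j \<in> {1..s}" for j
    using uw[of 0 j] t that by simp
  have inj_v: "inj_on v {..<t}"
    unfolding v_def by (intro inj_onI) (use nb(2) in \<open>metis lessThan_iff trans_less_add1\<close>)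
  have inj_w: "inj_on w {1..s}"
  proof (rule inj_onI)
    fix j j'
    assume *: "j \<in> {1..s}" "j' \<in> {1..s}" "w j = w j'"
    then have "t + (j - 1) < t + s" "t + (j' - 1) < t + s" by auto
    then have "t + (j - 1) = t + (j' - 1)" using nb(3)[of "t + (j - 1)" "t + (j' - 1)"] *(3) unfolding w_def by blast
    then show "j = j'" using * by auto
  qed
  define F where "F = insert u (v ` {..<t} \<union> w ` {1..s})"
  define I where "I = {..<t} \<times> {1..s}"
  have finF: "finite F" and finI: "finite I" by (simp_all add: F_def I_def)
  have "card F \<le> Suc (card (v ` {..<t} \<union> w ` {1..s}))" unfolding F_def by (simp add: card_insert_if)
  also have "\<dots> \<le> 1 + (t + s)"
    using card_Un_le[of "v ` {..<t}" "w ` {1..s}"] card_image_le[of "{..<t}" v] card_image_le[of "{1..s}" w] by simp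
  finally have cF: "card F \<le> 1 + (t + s)" .
  have richI: "rich k m (v (fst i)) (w (snd i))" if "i \<in> I" for i
    using that rich by (auto simp: I_def)
  have cm: "card F + card I * (k - 1) \<le> m" using cF by (simp add: m_def I_def card_cartesian_product)
  have "\<exists>p. \<forall>i\<in>I. p i \<in> walks_betw k (v (fst i)) (w (snd i)) \<and> distinct (p i) \<and>
    (\<forall>a\<in>{1..<k}. p i ! a \<notin> F \<and> (\<forall>j\<in>I. \<forall>b\<in>{1..<k}. p i ! a = p j ! b \<longrightarrow> i = j \<and> a = b))"
    by (rule rich_disjoint_paths[OF finI finF cm richI])
  then obtain p where p: "\<forall>i\<in>I. p i \<in> walks_betw k (v (fst i)) (w (snd i)) \<and> distinct (p i) \<and>
    (\<forall>a\<in>{1..<k}. p i ! a \<notin> F \<and> (\<forall>j\<in>I. \<forall>b\<in>{1..<k}. p i ! a = p j ! b \<longrightarrow> i = j \<and> a = b))"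
    by (elim exE)
  have pw: "p (i, j) \<in> walks_betw k (v i) (w j)" if "i < t" "j \<in> {1..s}" for i j
    using p[THEN bspec, of "(i, j)"] that by (simp add: I_def)
  show ?thesis
  proof (rule L_graph_embedding[where x = "\<lambda>i j a. p (i, j) ! a"])
    show "{p (i, j) ! a, p (i, j) ! Suc a} \<in> edges G" if "i < t" "j \<in> {1..s}" "a < k" for i j a
      using pw[OF that(1,2)] that(3) by (intro E_G walks_adj[of _ k]) (auto simp: walks_betw_def)
    show "p (i, j) ! 0 = v i" "p (i, j) ! k = w j" if "i < t" "j \<in> {1..s}" for i j
      using pw[OF that] by (auto simp: walks_betw_def)
    show "p (i, j) ! a \<notin> insert u (v ` {..<t} \<union> w ` {1..s})" if "i < t" "j \<in> {1..s}" "a \<in> {1..<k}" for i j a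
    proof -
      have "(i, j) \<in> I" using that by (simp add: I_def)
      then show ?thesis using p[THEN bspec, THEN conjunct2, THEN conjunct2, THEN bspec, THEN conjunct1] that(3)
        unfolding F_def by blast
    qed
    show "i = i' \<and> j = j' \<and> a = a'" if "i < t" "j \<in> {1..s}" "a \<in> {1..<k}" "i' < t" "j' \<in> {1..s}" "a' \<in> {1..<k}"
      "p (i, j) ! a = p (i', j') ! a'" for i j a i' j' a'
    proof -
      have "(i, j) \<in> I" "(i', j') \<in> I" using that by (simp_all add: I_def)
      then have "(i, j) = (i', j') \<and> a = a'"
        using p[THEN bspec, THEN conjunct2, THEN conjunct2, THEN bspec, THEN conjunct2, THEN bspec, THEN bspec] that(3,6,7)
        by blast
      then show ?thesis by simp
    qed
  qed (use G E_G k t uv inj_v inj_w uw vw in auto)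
qed

end

section \<open>Few closed walks\<close>

text \<open>Lists are built by adding heads. The at most s elements already present exclude at most
  s b new heads, so each of the s steps leaves at least card S - s b choices.\<close>

lemma card_sorted_wrt_lists:
  fixes R :: "'b \<Rightarrow> 'b \<Rightarrow> bool"
  assumes "finite S" and deg: "\<And>y. y \<in> S \<Longrightarrow> real (card {x \<in> S. R x y}) \<le> b"
    and b: "b \<ge> 0" and "real s * b \<le> real (card S)"
  shows "real (card {xs. length xs = s \<and> set xs \<subseteq> S \<and> sorted_wrt (\<lambda>x y. \<not> R x y) xs}) \<ge> (real (card S) - real s * b) ^ s"
proof -
  define r where "r = real (card S) - real s * b"
  define L where "L n = {xs. length xs = n \<and> set xs \<subseteq> S \<and> sorted_wrt (\<lambda>x y. \<not> R x y) xs}" for n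
  have finL: "finite (L n)" for n
    by (rule finite_subset[OF _ finite_lists_length_eq[OF assms(1), of n]]) (auto simp: L_def)
  have "n \<le> s \<Longrightarrow> real (card (L n)) \<ge> r ^ n" for n
  proof (induction n)
    case 0
    have "L 0 = {[]}" by (auto simp: L_def)
    then show ?case by simp
  next
    case (Suc n)
    define X where "X xs = S - (\<Union>y\<in>set xs. {x \<in> S. R x y})" for xs
    have X: "real (card (X xs)) \<ge> r" if xs: "xs \<in> L n" for xs
    proof -
      let ?U = "\<Union>y\<in>set xs. {x \<in> S. R x y}"
      have "real (card ?U) \<le> (\<Sum>y\<in>set xs. real (card {x \<in> S. R x y}))"
        using of_nat_mono[OF card_UN_le[OF finite_set], of "\<lambda>y. {x \<in> S. R x y}" xs, where 'a = real] by simp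
      also have "\<dots> \<le> (\<Sum>y\<in>set xs. b)" using xs by (intro sum_mono deg) (auto simp: L_def)
      also have "\<dots> = real (card (set xs)) * b" by simp
      also have "\<dots> \<le> real s * b"
        using xs Suc.prems b card_length[of xs] by (intro mult_right_mono) (auto simp: L_def)
      finally have "real (card ?U) \<le> real s * b" .
      moreover have "card S - card ?U \<le> card (X xs)"
        unfolding X_def using assms(1) by (intro diff_card_le_card_Diff) auto
      ultimately show ?thesis unfolding r_def by linarith
    qed
    have "(\<lambda>(xs, x). x # xs) ` (SIGMA xs:L n. X xs) \<subseteq> L (Suc n)"
      by (auto simp: L_def X_def)
    then have "card ((\<lambda>(xs, x). x # xs) ` (SIGMA xs:L n. X xs)) \<le> card (L (Suc n))"
      by (intro card_mono finL)
    moreover have "card ((\<lambda>(xs, x). x # xs) ` (SIGMA xs:L n. X xs)) = card (SIGMA xs:L n. X xs)"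
      by (intro card_image inj_onI) auto
    moreover have "card (SIGMA xs:L n. X xs) = (\<Sum>xs\<in>L n. card (X xs))"
      using finL assms(1) by (intro card_SigmaI) (auto simp: X_def)
    ultimately have "(\<Sum>xs\<in>L n. real (card (X xs))) \<le> real (card (L (Suc n)))"
      by (metis of_nat_le_iff of_nat_sum)
    moreover have "(\<Sum>xs\<in>L n. real (card (X xs))) \<ge> (\<Sum>xs\<in>L n. r)" by (intro sum_mono X)
    moreover have "r ^ n * r \<le> real (card (L n)) * r"
      using Suc assms(4) by (intro mult_right_mono) (auto simp: r_def)
    ultimately show ?case by (simp add: mult.commute)
  qed
  then show ?thesis unfolding L_def r_def by simp
qed

section \<open>Counting walks with a bounded number of parallel walks\<close>

context almost_regular
begin

lemma D_nonneg: "x \<in> V \<Longrightarrow> D \<ge> 0"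
  using deg_le[of x] by linarith

lemma card_walks_from_Suc:
  assumes "x \<in> V"
  shows "card (walks_from (Suc n) x) = (\<Sum>y\<in>nbrs x. card (walks_from n y))"
proof -
  have "card (walks_from (Suc n) x) = (\<Sum>y\<in>nbrs x. card {p \<in> walks_from (Suc n) x. p ! 1 = y})"
    using walks_adj[of _ "Suc n" 0] by (intro card_fibres) (auto simp: walks_from_def, simp add: nbrs_def)
  also have "\<dots> = (\<Sum>y\<in>nbrs x. card (walks_from n y))"
  proof (intro sum.cong refl)
    fix y assume y: "y \<in> nbrs x"
    have "{p \<in> walks_from (Suc n) x. p ! 1 = y} 
      = {p \<in> walks (Suc n). p ! 1 = y \<and> (\<lambda>q. q ! 0 = x) (take (Suc 1) p) \<and> (\<lambda>_. True) (drop 1 p)}"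
      by (auto simp: walks_from_def)
    then have "card {p \<in> walks_from (Suc n) x. p ! 1 = y}
      = card {q \<in> walks 1. q ! 1 = y \<and> q ! 0 = x} * card {r \<in> walks (Suc n - 1). r ! 0 = y \<and> True}"
      using card_walks_cut[of 1 "Suc n" y "\<lambda>q. q ! 0 = x" "\<lambda>_. True"] by simp
    moreover have "{q \<in> walks 1. q ! 1 = y \<and> q ! 0 = x} = {[x, y]}"
      using y assms nbrs_subset[of x] by (auto simp: walks_def length_Suc_conv nbrs_def)
    ultimately show "card {p \<in> walks_from (Suc n) x. p ! 1 = y} = card (walks_from n y)"
      by (simp add: walks_from_def)
  qed
  finally show ?thesis .
qed

lemma card_walks_from:
  assumes "x \<in> V"
  shows "d ^ n \<le> real (card (walks_from n x))" "real (card (walks_from n x)) \<le> D ^ n"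
proof -
  have "d ^ n \<le> real (card (walks_from n x)) \<and> real (card (walks_from n x)) \<le> D ^ n"
    using assms
  proof (induction n arbitrary: x)
    case 0
    have "walks_from 0 x = {[x]}"
      using 0 by (auto simp: walks_from_def walks_def length_Suc_conv)
    then show ?case by simp
  next
    case (Suc n)
    have eq: "real (card (walks_from (Suc n) x)) = (\<Sum>y\<in>nbrs x. real (card (walks_from n y)))"
      by (simp add: card_walks_from_Suc[OF Suc.prems])
    have y: "y \<in> V" if "y \<in> nbrs x" for y using that nbrs_subset by blast
    have "d * d ^ n \<le> real (card (nbrs x)) * d ^ n"
      using deg_ge[OF Suc.prems] d_pos by (intro mult_right_mono) auto
    also have "\<dots> = (\<Sum>y\<in>nbrs x. d ^ n)" by simp
    also have "\<dots> \<le> real (card (walks_from (Suc n) x))"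
      unfolding eq using Suc.IH y by (intro sum_mono) blast
    finally have 1: "d ^ Suc n \<le> real (card (walks_from (Suc n) x))" by simp
    have "real (card (walks_from (Suc n) x)) \<le> (\<Sum>y\<in>nbrs x. D ^ n)"
      unfolding eq using Suc.IH y by (intro sum_mono) blast
    also have "\<dots> = real (card (nbrs x)) * D ^ n" by simp
    also have "\<dots> \<le> D * D ^ n"
      using deg_le[OF Suc.prems] D_nonneg[OF Suc.prems] by (intro mult_right_mono) auto
    finally show ?case using 1 by simp
  qed
  then show "d ^ n \<le> real (card (walks_from n x))" "real (card (walks_from n x)) \<le> D ^ n" by blast+
qed

lemma card_walks_from_le: "D \<ge> 0 \<Longrightarrow> real (card (walks_from n x)) \<le> D ^ n"
proof (cases "x \<in> V")
  case False
  then have "walks_from n x = {}" by (auto simp: walks_from_def walks_nth_in)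
  then show "D \<ge> 0 \<Longrightarrow> ?thesis" by simp
qed (use card_walks_from in simp)

text \<open>A step determined by the past saves one factor D. Letting g see the whole prefix covers
  both a return to an earlier vertex and a visit to a fixed vertex.\<close>

lemma card_walks_forced_vertex:
  assumes D: "D \<ge> 0" and "1 \<le> b" "b \<le> n"
  shows "real (card {p \<in> walks_from n x. p ! b = g (take b p)}) \<le> D ^ (n - 1)"
proof -
  obtain c where c: "b = Suc c" using assms(2) by (cases b) auto
  let ?A = "{p \<in> walks_from n x. p ! b = g (take b p)}"
  have "card ?A \<le> card (SIGMA q:walks_from c x. walks_from (n - b) (g q))"
  proof (rule card_inj_on_le[where f = "\<lambda>p. (take b p, drop b p)"])
    show "inj_on (\<lambda>p. (take b p, drop b p)) ?A"
      by (rule inj_onI) (metis append_take_drop_id prod.inject)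
    show "(\<lambda>p. (take b p, drop b p)) ` ?A \<subseteq> (SIGMA q:walks_from c x. walks_from (n - b) (g q))"
      using assms c by (auto simp: walks_from_def take_walks drop_walks walks_length)
  qed simp
  also have "\<dots> = (\<Sum>q\<in>walks_from c x. card (walks_from (n - b) (g q)))" by (intro card_SigmaI) auto
  finally have "real (card ?A) \<le> (\<Sum>q\<in>walks_from c x. real (card (walks_from (n - b) (g q))))"
    by (simp flip: of_nat_sum)
  also have "\<dots> \<le> (\<Sum>q\<in>walks_from c x. D ^ (n - b))" by (intro sum_mono card_walks_from_le D)
  also have "\<dots> \<le> D ^ c * D ^ (n - b)"
    using card_walks_from_le[OF D, of c x] D by (simp add: mult_right_mono)
  also have "\<dots> = D ^ (n - 1)" using c assms(3) by (simp flip: power_add)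
  finally show ?thesis .
qed

lemma card_walks_prefix:
  assumes D: "D \<ge> 0" and Q: "Q \<subseteq> walks j" and j: "j \<le> n"
  shows "real (card {p \<in> walks n. take (Suc j) p \<in> Q}) \<le> real (card Q) * D ^ (n - j)"
proof -
  let ?A = "{p \<in> walks n. take (Suc j) p \<in> Q}"
  have finQ: "finite Q" using finite_subset[OF Q] by simp
  have "card ?A \<le> card (SIGMA q:Q. walks_from (n - j) (q ! j))"
  proof (rule card_inj_on_le[where f = "\<lambda>p. (take (Suc j) p, drop j p)"])
    show "inj_on (\<lambda>p. (take (Suc j) p, drop j p)) ?A"
      by (rule inj_onI) (metis append_take_drop_id drop_Suc prod.inject tl_drop)
    show "(\<lambda>p. (take (Suc j) p, drop j p)) ` ?A \<subseteq> (SIGMA q:Q. walks_from (n - j) (q ! j))"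
      using j by (auto simp: walks_from_def drop_walks walks_length)
  qed (use finQ in auto)
  also have "\<dots> = (\<Sum>q\<in>Q. card (walks_from (n - j) (q ! j)))" using finQ by (intro card_SigmaI) auto
  finally have "real (card ?A) \<le> (\<Sum>q\<in>Q. real (card (walks_from (n - j) (q ! j))))"
    by (simp flip: of_nat_sum)
  also have "\<dots> \<le> (\<Sum>q\<in>Q. D ^ (n - j))" by (intro sum_mono card_walks_from_le D)
  finally show ?thesis by simp
qed

lemma card_walks_suffix:
  assumes D: "D \<ge> 0" and Q: "Q \<subseteq> walks n"
  shows "real (card {p \<in> walks (Suc n). tl p \<in> Q}) \<le> real (card Q) * D"
proof -
  let ?A = "{p \<in> walks (Suc n). tl p \<in> Q}"
  have finQ: "finite Q" using finite_subset[OF Q] by simp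
  have "card ?A \<le> card (SIGMA q:Q. nbrs (q ! 0))"
  proof (rule card_inj_on_le[where f = "\<lambda>p. (tl p, p ! 0)"])
    show "inj_on (\<lambda>p. (tl p, p ! 0)) ?A"
    proof (rule inj_onI)
      fix p r assume "p \<in> ?A" "r \<in> ?A" "(tl p, p ! 0) = (tl r, r ! 0)"
      then show "p = r" by (cases p; cases r) (auto simp: walks_def)
    qed
    show "(\<lambda>p. (tl p, p ! 0)) ` ?A \<subseteq> (SIGMA q:Q. nbrs (q ! 0))"
    proof (rule image_subsetI)
      fix p assume "p \<in> ?A"
      then have p: "p \<in> walks (Suc n)" "tl p \<in> Q" by auto
      have "E (p ! 0) (p ! 1)" using walks_adj[OF p(1), of 0] by simp
      moreover have "tl p ! 0 = p ! 1" using walks_length[OF p(1)] by (simp add: nth_tl)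
      ultimately show "(tl p, p ! 0) \<in> (SIGMA q:Q. nbrs (q ! 0))" using p E_sym by (simp add: nbrs_def)
    qed
  qed (use finQ in auto)
  also have "\<dots> = (\<Sum>q\<in>Q. card (nbrs (q ! 0)))" using finQ by (intro card_SigmaI) auto
  finally have "real (card ?A) \<le> (\<Sum>q\<in>Q. real (card (nbrs (q ! 0))))" by (simp flip: of_nat_sum)
  also have "\<dots> \<le> (\<Sum>q\<in>Q. D)"
    using Q by (intro sum_mono deg_le) (auto intro!: walks_nth_in)
  finally show ?thesis by simp
qed

text \<open>A pair joined by N > B walks contributes N <= N^2 / B, and the squares sum to
  \<open>total_closed (2 * j)\<close>.\<close>

lemma card_heavy_walks:
  assumes B: "B > 0"
  shows "real (card {p \<in> walks j. num_walks j (p ! 0) (p ! j) > B}) \<le> total_closed (2 * j) / B"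
proof -
  let ?A = "{p \<in> walks j. num_walks j (p ! 0) (p ! j) > B}"
  have "card ?A = (\<Sum>xy\<in>V \<times> V. card {p \<in> ?A. (p ! 0, p ! j) = xy})"
    using finite_V by (intro card_fibres) (auto simp: walks_nth_in)
  then have "real (card ?A) = (\<Sum>xy\<in>V \<times> V. real (card {p \<in> ?A. (p ! 0, p ! j) = xy}))" by simp
  also have "\<dots> \<le> (\<Sum>xy\<in>V \<times> V. (num_walks j (fst xy) (snd xy))\<^sup>2 / B)"
  proof (rule sum_mono)
    fix xy :: "'a \<times> 'a"
    obtain x y where xy: "xy = (x, y)" by (cases xy)
    show "real (card {p \<in> ?A. (p ! 0, p ! j) = xy}) \<le> (num_walks j (fst xy) (snd xy))\<^sup>2 / B"
    proof (cases "num_walks j x y > B")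
      case True
      have "{p \<in> ?A. (p ! 0, p ! j) = xy} \<subseteq> walks_betw j x y" by (auto simp: walks_betw_def xy)
      then have "real (card {p \<in> ?A. (p ! 0, p ! j) = xy}) \<le> num_walks j x y"
        unfolding num_walks_def by (intro of_nat_mono card_mono) auto
      moreover have "num_walks j x y * B \<le> num_walks j x y * num_walks j x y"
        using True by (intro mult_left_mono) auto
      ultimately show ?thesis using B by (simp add: xy pos_le_divide_eq power2_eq_square)
          (smt (verit) mult_right_mono)
    next
      case False
      then have "{p \<in> ?A. (p ! 0, p ! j) = xy} = {}" by (auto simp: xy)
      then have "card {p \<in> ?A. (p ! 0, p ! j) = xy} = 0" by (simp only: card.empty)
      then show ?thesis using B by (simp only: of_nat_0) simp
    qed
  qed
  also have "\<dots> = total_closed (2 * j) / B"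
    by (simp add: total_closed_double case_prod_beta sum_divide_distrib)
  finally show ?thesis .
qed

text \<open>A good walk will be \<open>u # p\<close> with \<open>p\<close> a leg of a spider with body \<open>p ! 0\<close>. The bounds on walks from \<open>u\<close>
  and from the body limit the number of spiders with the same roots through a given vertex.\<close>

definition good_walk :: "real \<Rightarrow> nat \<Rightarrow> 'a list \<Rightarrow> bool" where
  "good_walk B k p \<longleftrightarrow> distinct p \<and> (\<forall>j\<in>{1..k}. num_walks j (p ! 0) (p ! j) \<le> B) \<and>
     num_walks k (p ! 1) (p ! Suc k) \<le> B"

lemma card_nondistinct_walks:
  assumes D: "D \<ge> 0"
  shows "real (card {p \<in> walks (Suc k). \<not> distinct p}) \<le> real ((k + 2)\<^sup>2) * (real (card V) * D ^ k)"
proof -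
  define I where "I = {(a, b). a < b \<and> b \<le> Suc k}"
  have I: "I \<subseteq> {..Suc k} \<times> {..Suc k}" by (auto simp: I_def)
  then have finI: "finite I" using finite_subset by blast
  have "card I \<le> (k + 2)\<^sup>2"
    using card_mono[OF _ I] by (simp add: card_cartesian_product power2_eq_square)
  then have cardI: "real (card I) \<le> real ((k + 2)\<^sup>2)" by (rule of_nat_mono)
  define X where "X ab = {p \<in> walks (Suc k). p ! snd ab = p ! fst ab}" for ab
  have "{p \<in> walks (Suc k). \<not> distinct p} \<subseteq> (\<Union>ab\<in>I. X ab)"
  proof
    fix p assume p: "p \<in> {p \<in> walks (Suc k). \<not> distinct p}"
    then obtain a b where "a < length p" "b < length p" "a \<noteq> b" "p ! a = p ! b"
      unfolding distinct_conv_nth by blast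
    then obtain a' b' where "a' < b'" "b' < length p" "p ! a' = p ! b'" by (metis nat_neq_iff)
    then have "(a', b') \<in> I" "p \<in> X (a', b')" using p walks_length[of p] by (auto simp: I_def X_def)
    then show "p \<in> (\<Union>ab\<in>I. X ab)" by blast
  qed
  then have "card {p \<in> walks (Suc k). \<not> distinct p} \<le> card (\<Union>ab\<in>I. X ab)"
    using finI by (intro card_mono) (auto simp: X_def)
  also have "\<dots> \<le> (\<Sum>ab\<in>I. card (X ab))" by (rule card_UN_le) (rule finI)
  finally have "real (card {p \<in> walks (Suc k). \<not> distinct p}) \<le> (\<Sum>ab\<in>I. real (card (X ab)))"
    by (simp flip: of_nat_sum)
  also have "\<dots> \<le> (\<Sum>ab\<in>I. real (card V) * D ^ k)"
  proof (rule sum_mono)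
    fix ab assume "ab \<in> I"
    then obtain a b where ab: "ab = (a, b)" "a < b" "b \<le> Suc k" by (auto simp: I_def)
    have "card (X ab) = (\<Sum>x\<in>V. card {p \<in> X ab. p ! 0 = x})"
      using finite_V by (intro card_fibres) (auto simp: X_def walks_nth_in)
    then have "real (card (X ab)) = (\<Sum>x\<in>V. real (card {p \<in> X ab. p ! 0 = x}))" by simp
    also have "\<dots> \<le> (\<Sum>x\<in>V. D ^ k)"
    proof (rule sum_mono)
      fix x
      have "{p \<in> X ab. p ! 0 = x} = {p \<in> walks_from (Suc k) x. p ! b = (\<lambda>q. q ! a) (take b p)}"
        using ab by (auto simp: X_def walks_from_def)
      then show "real (card {p \<in> X ab. p ! 0 = x}) \<le> D ^ k"
        using card_walks_forced_vertex[OF D, of b "Suc k" x "\<lambda>q. q ! a"] ab by simp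
    qed
    finally show "real (card (X ab)) \<le> real (card V) * D ^ k" by simp
  qed
  also have "\<dots> = real (card I) * (real (card V) * D ^ k)" by simp
  also have "\<dots> \<le> real ((k + 2)\<^sup>2) * (real (card V) * D ^ k)"
    using D by (intro mult_right_mono cardI) simp
  finally show ?thesis .
qed

text \<open>The three terms correspond to a repeated vertex, a heavy initial piece of length j, and
  a heavy final piece of length k. A heavy piece of length j extends to length k + 1 in at most D^(k
  + 1 - j) ways.\<close>

lemma card_not_good_walks:
  assumes D: "D \<ge> 0" and B: "B > 0"
  shows "real (card {p \<in> walks (Suc k). \<not> good_walk B k p})
    \<le> real ((k + 2)\<^sup>2) * (real (card V) * D ^ k)
      + (\<Sum>j\<in>{1..k}. total_closed (2 * j) / B * D ^ (Suc k - j)) + total_closed (2 * k) / B * D"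
proof -
  define Q where "Q j = {p \<in> walks j. num_walks j (p ! 0) (p ! j) > B}" for j
  define X where "X j = {p \<in> walks (Suc k). take (Suc j) p \<in> Q j}" for j
  define Y where "Y = {p \<in> walks (Suc k). tl p \<in> Q k}"
  define N where "N = {p \<in> walks (Suc k). \<not> distinct p}"
  have "{p \<in> walks (Suc k). \<not> good_walk B k p} \<subseteq> N \<union> (\<Union>j\<in>{1..k}. X j) \<union> Y"
  proof
    fix p assume "p \<in> {p \<in> walks (Suc k). \<not> good_walk B k p}"
    then have p: "p \<in> walks (Suc k)" and
      "\<not> distinct p \<or> (\<exists>j\<in>{1..k}. num_walks j (p ! 0) (p ! j) > B) \<or> num_walks k (p ! 1) (p ! Suc k) > B"
      by (auto simp: good_walk_def not_le)
    then consider "\<not> distinct p" | j where "j \<in> {1..k}" "num_walks j (p ! 0) (p ! j) > B"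
      | "num_walks k (p ! 1) (p ! Suc k) > B" by blast
    then show "p \<in> N \<union> (\<Union>j\<in>{1..k}. X j) \<union> Y"
    proof cases
      case 1
      then show ?thesis using p by (simp add: N_def)
    next
      case 2
      then have "p \<in> X j" using p by (simp add: X_def Q_def take_walks)
      then show ?thesis using 2(1) by blast
    next
      case 3
      have "tl p \<in> walks k" using drop_walks[OF p, of 1] by (simp add: drop_Suc)
      then have "p \<in> Y" using 3 p by (simp add: Y_def Q_def nth_tl walks_length)
      then show ?thesis by blast
    qed
  qed
  then have "card {p \<in> walks (Suc k). \<not> good_walk B k p} \<le> card (N \<union> (\<Union>j\<in>{1..k}. X j) \<union> Y)"
    by (intro card_mono) (auto simp: N_def X_def Y_def)
  also have "\<dots> \<le> card N + card (\<Union>j\<in>{1..k}. X j) + card Y"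
    by (intro order.trans[OF card_Un_le] add_right_mono card_Un_le)
  also have "\<dots> \<le> card N + (\<Sum>j\<in>{1..k}. card (X j)) + card Y"
    by (intro add_right_mono add_left_mono card_UN_le) simp
  finally have "real (card {p \<in> walks (Suc k). \<not> good_walk B k p})
     \<le> real (card N) + (\<Sum>j\<in>{1..k}. real (card (X j))) + real (card Y)"
    by (simp flip: of_nat_sum of_nat_add)
  moreover have "real (card N) \<le> real ((k + 2)\<^sup>2) * (real (card V) * D ^ k)"
    unfolding N_def by (rule card_nondistinct_walks[OF D])
  moreover have "(\<Sum>j\<in>{1..k}. real (card (X j))) \<le> (\<Sum>j\<in>{1..k}. total_closed (2 * j) / B * D ^ (Suc k - j))"
  proof (rule sum_mono)
    fix j assume j: "j \<in> {1..k}"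
    have "real (card (X j)) \<le> real (card (Q j)) * D ^ (Suc k - j)"
      unfolding X_def using j by (intro card_walks_prefix[OF D]) (auto simp: Q_def)
    also have "\<dots> \<le> total_closed (2 * j) / B * D ^ (Suc k - j)"
      using D unfolding Q_def by (intro mult_right_mono card_heavy_walks[OF B]) simp
    finally show "real (card (X j)) \<le> total_closed (2 * j) / B * D ^ (Suc k - j)" .
  qed
  moreover have "real (card Y) \<le> total_closed (2 * k) / B * D"
  proof -
    have "real (card Y) \<le> real (card (Q k)) * D"
      unfolding Y_def by (intro card_walks_suffix[OF D]) (auto simp: Q_def)
    also have "\<dots> \<le> total_closed (2 * k) / B * D"
      using D unfolding Q_def by (intro mult_right_mono card_heavy_walks[OF B])
    finally show ?thesis .
  qed
  ultimately show ?thesis by linarith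
qed

section \<open>Spiders: good legs, tuples of legs, and common roots\<close>

definition good_legs :: "real \<Rightarrow> nat \<Rightarrow> 'a \<Rightarrow> 'a \<Rightarrow> 'a list set" where
  "good_legs B k u v = {p \<in> walks_from k v. good_walk B k (u # p)}"

definition arcs :: "('a \<times> 'a) set" where
  "arcs = {(u, v). E u v}"

lemma finite_arcs [simp]: "finite arcs"
  by (rule finite_subset[of _ "V \<times> V"]) (auto simp: arcs_def E_in E_in2 finite_V)

lemma card_arcs: "real (card V) * d \<le> real (card arcs)"
proof -
  have "card arcs = card (SIGMA x:V. nbrs x)"
    by (rule arg_cong[where f = card]) (auto simp: arcs_def nbrs_def E_in)
  also have "\<dots> = (\<Sum>x\<in>V. card (nbrs x))" using finite_V by (intro card_SigmaI) auto
  finally have "real (card arcs) = (\<Sum>x\<in>V. real (card (nbrs x)))" by simp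
  also have "\<dots> \<ge> (\<Sum>x\<in>V. d)" by (intro sum_mono deg_ge)
  finally show ?thesis by simp
qed

lemma Cons_walks: "E u v \<Longrightarrow> p \<in> walks_from k v \<Longrightarrow> u # p \<in> walks (Suc k)"
  by (auto simp: walks_from_def walks_def E_in nth_Cons less_Suc_eq_0_disj)

text \<open>An arc outside the set has at least d^k / 2 walks through it that are not good. The
  assumed quarter therefore allows at most n d / 2 such arcs, out of at least n d.\<close>

lemma many_good_arcs:
  assumes bad: "real (card {p \<in> walks (Suc k). \<not> good_walk B k p}) \<le> real (card V) * d ^ Suc k / 4"
  shows "real (card {(u, v) \<in> arcs. real (card (good_legs B k u v)) \<ge> d ^ k / 2}) \<ge> real (card V) * d / 2"
proof -
  define F where "F = {(u, v) \<in> arcs. real (card (good_legs B k u v)) \<ge> d ^ k / 2}"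
  define N where "N uv = {p \<in> walks_from k (snd uv). \<not> good_walk B k (fst uv # p)}" for uv
  have "real (card (arcs - F)) * (d ^ k / 2) = (\<Sum>uv\<in>arcs - F. d ^ k / 2)" by simp
  also have "\<dots> \<le> (\<Sum>uv\<in>arcs - F. real (card (N uv)))"
  proof (rule sum_mono)
    fix uv assume uv: "uv \<in> arcs - F"
    obtain u v where uv': "uv = (u, v)" by (cases uv)
    have v: "v \<in> V" using uv E_in2 by (auto simp: uv' arcs_def)
    have "walks_from k v = good_legs B k u v \<union> N uv" by (auto simp: good_legs_def N_def uv')
    then have "card (walks_from k v) \<le> card (good_legs B k u v) + card (N uv)" by (simp add: card_Un_le)
    moreover have "real (card (good_legs B k u v)) < d ^ k / 2" using uv by (simp add: F_def uv' not_le)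
    ultimately show "d ^ k / 2 \<le> real (card (N uv))" using card_walks_from(1)[OF v, of k] by linarith
  qed
  also have "\<dots> \<le> (\<Sum>uv\<in>arcs. real (card (N uv)))" by (intro sum_mono2) auto
  also have "\<dots> = real (card (SIGMA uv:arcs. N uv))"
    by (subst card_SigmaI) (auto simp: N_def)
  also have "card (SIGMA uv:arcs. N uv) \<le> card {p \<in> walks (Suc k). \<not> good_walk B k p}"
  proof (rule card_inj_on_le[where f = "\<lambda>(uv, p). fst uv # p"])
    show "inj_on (\<lambda>(uv, p). fst uv # p) (SIGMA uv:arcs. N uv)"
      by (rule inj_onI) (auto simp: N_def walks_from_def)
    show "(\<lambda>(uv, p). fst uv # p) ` (SIGMA uv:arcs. N uv) \<subseteq> {p \<in> walks (Suc k). \<not> good_walk B k p}"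
      by (auto simp: N_def arcs_def intro: Cons_walks)
  qed simp
  finally have "real (card (arcs - F)) * (d ^ k / 2) \<le> real (card {p \<in> walks (Suc k). \<not> good_walk B k p})"
    by simp
  also have "\<dots> \<le> real (card V) * d / 2 * (d ^ k / 2)" using bad by simp
  finally have "real (card (arcs - F)) \<le> real (card V) * d / 2"
    by (rule mult_right_le_imp_le) (use d_pos in simp)
  moreover have "card arcs \<le> card F + card (arcs - F)"
  proof -
    have "F \<subseteq> arcs" by (auto simp: F_def)
    then show ?thesis using card_Un_le[of F "arcs - F"] by (simp add: Un_absorb1)
  qed
  ultimately have "real (card F) \<ge> real (card V) * d / 2" using card_arcs by linarith
  then show ?thesis by (simp add: F_def)
qed

text \<open>Position 0 is left out since all legs of a spider start at its body. Position k is
  included so that the feet of a spider are distinct.\<close>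

definition meet :: "nat \<Rightarrow> 'a list \<Rightarrow> 'a list \<Rightarrow> bool" where
  "meet k p q \<longleftrightarrow> (\<exists>a\<in>{1..k}. \<exists>b\<in>{1..k}. p ! a = q ! b)"

definition leg_tuples :: "real \<Rightarrow> nat \<Rightarrow> nat \<Rightarrow> 'a \<Rightarrow> 'a \<Rightarrow> 'a list list set" where
  "leg_tuples B k s u v = {xs. length xs = s \<and> set xs \<subseteq> good_legs B k u v \<and> sorted_wrt (\<lambda>p q. \<not> meet k p q) xs}"

lemma finite_good_legs [simp]: "finite (good_legs B k u v)"
  by (simp add: good_legs_def)

lemma finite_leg_tuples [simp]: "finite (leg_tuples B k s u v)"
  by (rule finite_subset[OF _ finite_lists_length_eq[of "good_legs B k u v" s]])
    (auto simp: leg_tuples_def)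

text \<open>A leg meeting a given one has a forced vertex for one of k^2 pairs of positions. By
  \<open>large\<close>, s legs exclude at most half of the d^k / 2 good ones, leaving d^k / 4
  choices for every entry.\<close>

lemma card_leg_tuples:
  assumes D: "D \<ge> 0" and legs: "real (card (good_legs B k u v)) \<ge> d ^ k / 2"
    and large: "real s * (real (k\<^sup>2) * D ^ (k - 1)) \<le> d ^ k / 4"
  shows "real (card (leg_tuples B k s u v)) \<ge> (d ^ k / 4) ^ s"
proof -
  let ?b = "real (k\<^sup>2) * D ^ (k - 1)" and ?S = "good_legs B k u v"
  have dk: "d ^ k / 4 \<ge> 0" using d_pos by simp
  have "real (card {p \<in> ?S. meet k p q}) \<le> ?b" for q
  proof -
    have "{p \<in> ?S. meet k p q} \<subseteq> (\<Union>ab\<in>{1..k} \<times> {1..k}. {p \<in> walks_from k v. p ! fst ab = (\<lambda>_. q ! snd ab) (take (fst ab) p)})"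
      by (auto simp: meet_def good_legs_def)
    then have "card {p \<in> ?S. meet k p q} \<le> card (\<Union>ab\<in>{1..k} \<times> {1..k}. {p \<in> walks_from k v. p ! fst ab = (\<lambda>_. q ! snd ab) (take (fst ab) p)})"
      by (intro card_mono) auto
    also have "\<dots> \<le> (\<Sum>ab\<in>{1..k} \<times> {1..k}. card {p \<in> walks_from k v. p ! fst ab = (\<lambda>_. q ! snd ab) (take (fst ab) p)})"
      by (intro card_UN_le) auto
    finally have "real (card {p \<in> ?S. meet k p q})
       \<le> (\<Sum>ab\<in>{1..k} \<times> {1..k}. real (card {p \<in> walks_from k v. p ! fst ab = (\<lambda>_. q ! snd ab) (take (fst ab) p)}))"
      by (simp flip: of_nat_sum)
    also have "\<dots> \<le> (\<Sum>ab\<in>{1..k} \<times> {1..k}. D ^ (k - 1))"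
      by (intro sum_mono card_walks_forced_vertex D) auto
    also have "\<dots> = ?b" by (simp add: card_cartesian_product power2_eq_square)
    finally show ?thesis .
  qed
  then have "(real (card ?S) - real s * ?b) ^ s \<le> real (card (leg_tuples B k s u v))"
    unfolding leg_tuples_def using legs large dk D by (intro card_sorted_wrt_lists) auto
  moreover have "(d ^ k / 4) ^ s \<le> (real (card ?S) - real s * ?b) ^ s"
    using legs large dk by (intro power_mono) auto
  ultimately show ?thesis by linarith
qed

definition spiders :: "real \<Rightarrow> nat \<Rightarrow> nat \<Rightarrow> 'a \<Rightarrow> 'a list \<Rightarrow> ('a \<times> 'a list list) set" where
  "spiders B k s u ws = {(v, xs). E u v \<and> xs \<in> leg_tuples B k s u v \<and> map (\<lambda>p. p ! k) xs = ws}"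

lemma finite_spiders [simp]: "finite (spiders B k s u ws)"
proof -
  have "spiders B k s u ws \<subseteq> (SIGMA v:V. leg_tuples B k s u v)"
    by (auto simp: spiders_def E_in2)
  then show ?thesis using finite_V by (rule_tac finite_subset) auto
qed

text \<open>Pigeonhole: at least (n d / 2) (d^k / 4)^s spiders are distributed over the n^(s + 1)
  choices of u and ws.\<close>

lemma many_spiders:
  assumes D: "D \<ge> 0" and bad: "real (card {p \<in> walks (Suc k). \<not> good_walk B k p}) \<le> real (card V) * d ^ Suc k / 4"
    and large: "real s * (real (k\<^sup>2) * D ^ (k - 1)) \<le> d ^ k / 4"
    and R: "real (card V) ^ (s + 1) * R < real (card V) * d / 2 * (d ^ k / 4) ^ s"
  shows "\<exists>u ws. R < real (card (spiders B k s u ws))"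
proof (rule ccontr)
  assume "\<not> ?thesis"
  then have le: "real (card (spiders B k s u ws)) \<le> R" for u ws by (simp add: not_less)
  define F where "F = {(u, v) \<in> arcs. real (card (good_legs B k u v)) \<ge> d ^ k / 2}"
  define W where "W = {ws. set ws \<subseteq> V \<and> length ws = s}"
  have finF: "finite F" by (rule finite_subset[of _ arcs]) (auto simp: F_def)
  have finW: "finite W" unfolding W_def by (rule finite_lists_length_eq[OF finite_V])
  have dk: "d ^ k / 4 \<ge> 0" using d_pos by simp
  define S where "S = (SIGMA uv:F. leg_tuples B k s (fst uv) (snd uv))"
  have finS: "finite S" using finF by (simp add: S_def)
  have "real (card V) * d / 2 * (d ^ k / 4) ^ s \<le> real (card F) * (d ^ k / 4) ^ s"
    using many_good_arcs[OF bad] dk unfolding F_def by (intro mult_right_mono) auto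
  also have "\<dots> = (\<Sum>uv\<in>F. (d ^ k / 4) ^ s)" by simp
  also have "\<dots> \<le> (\<Sum>uv\<in>F. real (card (leg_tuples B k s (fst uv) (snd uv))))"
    by (intro sum_mono card_leg_tuples D large) (auto simp: F_def)
  also have "\<dots> = real (card S)" using finF unfolding S_def by (subst card_SigmaI) auto
  also have "card S = (\<Sum>y\<in>V \<times> W. card {x \<in> S. (fst (fst x), map (\<lambda>p. p ! k) (snd x)) = y})"
    using finite_V finW finS
    by (intro card_fibres)
      (auto simp: S_def F_def arcs_def W_def leg_tuples_def good_legs_def walks_from_def E_in subset_iff intro!: walks_nth_in)
  also have "real \<dots> \<le> (\<Sum>y\<in>V \<times> W. R)"
    unfolding of_nat_sum
  proof (rule sum_mono)
    fix y :: "'a \<times> 'a list"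
    obtain u ws where y: "y = (u, ws)" by (cases y)
    have "card {x \<in> S. (fst (fst x), map (\<lambda>p. p ! k) (snd x)) = y} \<le> card (spiders B k s u ws)"
    proof (rule card_inj_on_le[where f = "\<lambda>x. (snd (fst x), snd x)"])
      show "inj_on (\<lambda>x. (snd (fst x), snd x)) {x \<in> S. (fst (fst x), map (\<lambda>p. p ! k) (snd x)) = y}"
        by (rule inj_onI) (auto simp: y prod_eq_iff)
      show "(\<lambda>x. (snd (fst x), snd x)) ` {x \<in> S. (fst (fst x), map (\<lambda>p. p ! k) (snd x)) = y} \<subseteq> spiders B k s u ws"
        by (auto simp: S_def F_def arcs_def spiders_def y)
    qed simp
    then show "real (card {x \<in> S. (fst (fst x), map (\<lambda>p. p ! k) (snd x)) = y}) \<le> R"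
      using le[of u ws] by linarith
  qed
  also have "\<dots> = real (card V) ^ (s + 1) * R"
    using card_lists_length_eq[OF finite_V, of s] by (simp add: card_cartesian_product W_def)
  finally show False using R by simp
qed

text \<open>Only non-root vertices are collected: u and the feet at position k are shared by all
  copies in the blowup, so disjointness is wanted only for the rest.\<close>

definition spider_verts :: "nat \<Rightarrow> 'a \<times> 'a list list \<Rightarrow> 'a set" where
  "spider_verts k \<sigma> = insert (fst \<sigma>) (\<Union>p\<in>set (snd \<sigma>). (!) p ` {1..<k})"

lemma card_spider_verts:
  assumes "\<sigma> \<in> spiders B k s u ws"
  shows "finite (spider_verts k \<sigma>)" "card (spider_verts k \<sigma>) \<le> 1 + s * k"
proof -
  have "length (snd \<sigma>) = s" using assms by (auto simp: spiders_def leg_tuples_def)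
  then have l: "card (set (snd \<sigma>)) \<le> s" using card_length by blast
  have "card (\<Union>p\<in>set (snd \<sigma>). (!) p ` {1..<k}) \<le> (\<Sum>p\<in>set (snd \<sigma>). card ((!) p ` {1..<k}))"
    by (rule card_UN_le) simp
  also have "\<dots> \<le> (\<Sum>p\<in>set (snd \<sigma>). k)"
    by (intro sum_mono order.trans[OF card_image_le]) auto
  also have "\<dots> \<le> s * k" using l by simp
  finally have "card (\<Union>p\<in>set (snd \<sigma>). (!) p ` {1..<k}) \<le> s * k" .
  then show "card (spider_verts k \<sigma>) \<le> 1 + s * k"
    unfolding spider_verts_def by (intro order.trans[OF card_insert_le_m1]) auto
  show "finite (spider_verts k \<sigma>)" by (simp add: spider_verts_def)
qed

text \<open>If z lies on a leg at distance a from the body, the body is the second vertex of one of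
  at most B walks of length a + 1 from u to z; otherwise the body is z. Once the body is known,
  every leg is one of at most B walks from it to one of the s feet.\<close>

lemma card_spiders_through:
  assumes B: "B \<ge> 0"
  shows "real (card {\<sigma> \<in> spiders B k s u ws. z \<in> spider_verts k \<sigma>}) \<le> (1 + real k * B) * (real s * B) ^ s"
proof -
  \<comment> \<open>\<open>A\<close> and \<open>J\<close> keep only the lengths and feet for which
    the bound B holds. Any spider counted below certifies membership through
    \<open>good_walk\<close>.\<close>
  define A where "A = {a \<in> {1..<k}. num_walks (Suc a) u z \<le> B}"
  define X where "X = insert z (\<Union>a\<in>A. (\<lambda>q. q ! 1) ` walks_betw (Suc a) u z)"
  define J where "J v = {j \<in> {..<s}. num_walks k v (ws ! j) \<le> B}" for v
  define Y where "Y v = (\<Union>j\<in>J v. walks_betw k v (ws ! j))" for v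
  define L where "L v = {xs. set xs \<subseteq> Y v \<and> length xs = s}" for v
  have finA: "finite A" and finJ: "finite (J v)" for v by (auto simp: A_def J_def)
  have finX: "finite X" using finA by (simp add: X_def)
  have finY: "finite (Y v)" for v using finJ by (simp add: Y_def)
  have finL: "finite (L v)" for v unfolding L_def by (rule finite_lists_length_eq[OF finY])
  have cX: "real (card X) \<le> 1 + real k * B"
  proof -
    let ?U = "\<Union>a\<in>A. (\<lambda>q. q ! 1) ` walks_betw (Suc a) u z"
    have "card ?U \<le> (\<Sum>a\<in>A. card ((\<lambda>q. q ! 1) ` walks_betw (Suc a) u z))" by (rule card_UN_le[OF finA])
    also have "\<dots> \<le> (\<Sum>a\<in>A. card (walks_betw (Suc a) u z))" by (intro sum_mono card_image_le) simp
    finally have "real (card ?U) \<le> (\<Sum>a\<in>A. num_walks (Suc a) u z)" by (simp add: num_walks_def flip: of_nat_sum)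
    also have "\<dots> \<le> (\<Sum>a\<in>A. B)" by (intro sum_mono) (simp add: A_def)
    also have "\<dots> = real (card A) * B" by simp
    also have "\<dots> \<le> real k * B"
    proof (intro mult_right_mono B of_nat_mono)
      have "card A \<le> card {1..<k}" by (intro card_mono) (auto simp: A_def)
      then show "card A \<le> k" by simp
    qed
    finally have "real (card ?U) \<le> real k * B" .
    moreover have "card X \<le> 1 + card ?U" unfolding X_def using finA by (simp add: card_insert_if)
    ultimately show ?thesis by linarith
  qed
  have cL: "real (card (L v)) \<le> (real s * B) ^ s" for v
  proof -
    have "card (Y v) \<le> (\<Sum>j\<in>J v. card (walks_betw k v (ws ! j)))" unfolding Y_def by (rule card_UN_le[OF finJ])
    then have "real (card (Y v)) \<le> (\<Sum>j\<in>J v. num_walks k v (ws ! j))" by (simp add: num_walks_def flip: of_nat_sum)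
    also have "\<dots> \<le> (\<Sum>j\<in>J v. B)" by (intro sum_mono) (simp add: J_def)
    also have "\<dots> = real (card (J v)) * B" by simp
    also have "\<dots> \<le> real s * B"
    proof (intro mult_right_mono B of_nat_mono)
      have "card (J v) \<le> card {..<s}" by (intro card_mono) (auto simp: J_def)
      then show "card (J v) \<le> s" by simp
    qed
    finally have "real (card (Y v)) ^ s \<le> (real s * B) ^ s" by (intro power_mono) auto
    then show ?thesis unfolding L_def by (simp add: card_lists_length_eq[OF finY])
  qed
  have "{\<sigma> \<in> spiders B k s u ws. z \<in> spider_verts k \<sigma>} \<subseteq> (SIGMA v:X. L v)"
  proof
    fix \<sigma> assume s: "\<sigma> \<in> {\<sigma> \<in> spiders B k s u ws. z \<in> spider_verts k \<sigma>}"
    obtain v xs where \<sigma>: "\<sigma> = (v, xs)" by (cases \<sigma>)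
    have xs: "xs \<in> leg_tuples B k s u v" and ws: "ws = map (\<lambda>p. p ! k) xs" and Euv: "E u v"
      and z: "z \<in> spider_verts k (v, xs)" using s by (auto simp: spiders_def \<sigma>)
    have len: "length xs = s" and legs: "\<And>p. p \<in> set xs \<Longrightarrow> p \<in> good_legs B k u v"
      using xs by (auto simp: leg_tuples_def)
    have leg: "p \<in> walks k" "p ! 0 = v" "good_walk B k (u # p)" "length p = Suc k" if "p \<in> set xs" for p
      using legs[OF that] walks_length[of p] by (auto simp: good_legs_def walks_from_def)
    have "v \<in> X"
    proof (cases "z = v")
      case True
      then show ?thesis by (simp add: X_def)
    next
      case False
      then obtain p a where pa: "p \<in> set xs" "a \<in> {1..<k}" "z = p ! a" using z by (auto simp: spider_verts_def)
      have "num_walks (Suc a) u z \<le> B"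
        using leg(3)[OF pa(1)] pa(2,3) unfolding good_walk_def
        by (metis Suc_leI atLeastAtMost_iff atLeastLessThan_iff le_SucI nth_Cons_0 nth_Cons_Suc)
      then have a: "a \<in> A" using pa by (simp add: A_def)
      have "u # p \<in> walks (Suc k)" using leg[OF pa(1)] Euv by (intro Cons_walks) (auto simp: walks_from_def)
      then have "take (Suc (Suc a)) (u # p) \<in> walks (Suc a)" using pa(2) by (intro take_walks) auto
      then have "take (Suc (Suc a)) (u # p) \<in> walks_betw (Suc a) u z"
        using pa by (simp add: walks_betw_def)
      moreover have "v = take (Suc (Suc a)) (u # p) ! 1" using leg(2)[OF pa(1)] leg(4)[OF pa(1)] by simp
      ultimately show ?thesis unfolding X_def using a by blast
    qed
    moreover have "set xs \<subseteq> Y v"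
    proof
      fix p assume p: "p \<in> set xs"
      then obtain j where j: "j < s" "p = xs ! j" using len by (auto simp: in_set_conv_nth)
      have pk: "p ! k = ws ! j" using j len ws by simp
      have "num_walks k v (ws ! j) \<le> B"
        using leg[OF p] pk by (simp add: good_walk_def)
      then have "j \<in> J v" using j by (simp add: J_def)
      moreover have "p \<in> walks_betw k v (ws ! j)" using leg[OF p] pk by (simp add: walks_betw_def)
      ultimately show "p \<in> Y v" by (auto simp: Y_def)
    qed
    ultimately show "\<sigma> \<in> (SIGMA v:X. L v)" using len by (simp add: \<sigma> L_def)
  qed
  then have "card {\<sigma> \<in> spiders B k s u ws. z \<in> spider_verts k \<sigma>} \<le> card (SIGMA v:X. L v)"
    using finX finL by (intro card_mono) auto
  also have "\<dots> = (\<Sum>v\<in>X. card (L v))" using finX finL by (intro card_SigmaI) auto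
  finally have "real (card {\<sigma> \<in> spiders B k s u ws. z \<in> spider_verts k \<sigma>}) \<le> (\<Sum>v\<in>X. real (card (L v)))"
    by (simp flip: of_nat_sum)
  also have "\<dots> \<le> (\<Sum>v\<in>X. (real s * B) ^ s)" by (intro sum_mono cL)
  also have "\<dots> = real (card X) * (real s * B) ^ s" by simp
  also have "\<dots> \<le> (1 + real k * B) * (real s * B) ^ s" using B by (intro mult_right_mono cX) simp
  finally show ?thesis .
qed

text \<open>A spider has at most 1 + s k vertices outside the roots, each on boundedly many other
  spiders with these roots. So t pairwise disjoint ones can be chosen greedily, and they form the
  blowup.\<close>

lemma contains_copy_if_many_spiders:
  fixes G :: "'a graph"
  assumes G: "simple_graph G" and E_G: "\<And>x y. E x y \<Longrightarrow> {x, y} \<in> edges G"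
    and k: "k \<ge> 1" and t: "t \<ge> 1" and B: "B \<ge> 0"
    and many: "real t * (real (1 + s * k) * ((1 + real k * B) * (real s * B) ^ s)) < real (card (spiders B k s u ws))"
  shows "contains_copy G (L_graph s t k)"
proof -
  let ?S = "spiders B k s u ws" and ?b = "(1 + real k * B) * (real s * B) ^ s"
  have b: "?b \<ge> 0" using B by simp
  have "\<exists>f. (\<forall>a<t. f a \<in> ?S) \<and> (\<forall>a<t. \<forall>b<a. \<not> (spider_verts k (f b) \<inter> spider_verts k (f a) \<noteq> {}))"
  proof (rule conflict_free_choice[OF finite_spiders _ _ many])
    fix \<sigma> assume \<sigma>: "\<sigma> \<in> ?S"
    note sv = card_spider_verts[OF \<sigma>]
    have "card {\<tau> \<in> ?S. spider_verts k \<sigma> \<inter> spider_verts k \<tau> \<noteq> {}}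
       \<le> card (\<Union>z\<in>spider_verts k \<sigma>. {\<tau> \<in> ?S. z \<in> spider_verts k \<tau>})"
      using sv(1) by (intro card_mono) auto
    also have "\<dots> \<le> (\<Sum>z\<in>spider_verts k \<sigma>. card {\<tau> \<in> ?S. z \<in> spider_verts k \<tau>})"
      by (rule card_UN_le[OF sv(1)])
    finally have "real (card {\<tau> \<in> ?S. spider_verts k \<sigma> \<inter> spider_verts k \<tau> \<noteq> {}})
       \<le> (\<Sum>z\<in>spider_verts k \<sigma>. real (card {\<tau> \<in> ?S. z \<in> spider_verts k \<tau>}))"
      by (simp flip: of_nat_sum)
    also have "\<dots> \<le> (\<Sum>z\<in>spider_verts k \<sigma>. ?b)" by (intro sum_mono card_spiders_through B)
    also have "\<dots> = real (card (spider_verts k \<sigma>)) * ?b" by simp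
    also have "\<dots> \<le> real (1 + s * k) * ?b" by (intro mult_right_mono of_nat_mono sv(2) b)
    finally show "real (card {\<tau> \<in> ?S. spider_verts k \<sigma> \<inter> spider_verts k \<tau> \<noteq> {}}) \<le> real (1 + s * k) * ?b" .
  qed (use b in simp)
  then obtain f where f: "\<forall>a<t. f a \<in> ?S" and disj: "\<forall>a<t. \<forall>b<a. \<not> (spider_verts k (f b) \<inter> spider_verts k (f a) \<noteq> {})"
    by (elim exE conjE)
  have disjoint: "i = i'" if "i < t" "i' < t" "z \<in> spider_verts k (f i)" "z \<in> spider_verts k (f i')" for i i' z
    using disj that by (metis IntI empty_iff nat_neq_iff)
  define v where "v i = fst (f i)" for i
  define w where "w j = ws ! (j - 1)" for j
  define P where "P i j = snd (f i) ! (j - 1)" for i j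
  have E_uv: "E u (v i)" and tup: "snd (f i) \<in> leg_tuples B k s u (v i)"
    and ends: "map (\<lambda>p. p ! k) (snd (f i)) = ws" if "i < t" for i
    using f that unfolding spiders_def v_def by (auto simp: case_prod_beta)
  have len: "length (snd (f i)) = s" if "i < t" for i using tup[OF that] by (simp add: leg_tuples_def)
  have P_in: "P i j \<in> set (snd (f i))" if "i < t" "j \<in> {1..s}" for i j
    unfolding P_def using len that by (intro nth_mem) auto
  then have leg: "P i j \<in> good_legs B k u (v i)" if "i < t" "j \<in> {1..s}" for i j
    using tup that unfolding leg_tuples_def by blast
  have P_walk: "P i j \<in> walks k" and P_0: "P i j ! 0 = v i" and P_dist: "distinct (u # P i j)"
    if "i < t" "j \<in> {1..s}" for i j
    using leg[OF that] by (auto simp: good_legs_def walks_from_def good_walk_def)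
  have P_len: "length (P i j) = Suc k" if "i < t" "j \<in> {1..s}" for i j
    using P_walk[OF that] by (rule walks_length)
  have P_k: "P i j ! k = w j" if "i < t" "j \<in> {1..s}" for i j
  proof -
    have "ws ! (j - 1) = P i j ! k" unfolding ends[OF that(1), symmetric] P_def
      using len that by (intro nth_map) auto
    then show ?thesis by (simp add: w_def)
  qed
  have P_ne_u: "P i j ! a \<noteq> u" if "i < t" "j \<in> {1..s}" "a \<le> k" for i j a
    using P_dist[OF that(1,2)] P_len[OF that(1,2)] that(3) nth_mem[of a "P i j"] by auto
  have P_inj: "a = b" if "i < t" "j \<in> {1..s}" "P i j ! a = P i j ! b" "a \<le> k" "b \<le> k" for i j a b
    using P_dist[OF that(1,2)] P_len[OF that(1,2)] that(3-5) by (simp add: nth_eq_iff_index_eq)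
  have P_legs: "j = j'" if "i < t" "j \<in> {1..s}" "j' \<in> {1..s}" "P i j ! a = P i j' ! b" "a \<in> {1..k}" "b \<in> {1..k}" for i j j' a b
  proof -
    have sorted: "sorted_wrt (\<lambda>p q. \<not> meet k p q) (snd (f i))" using tup[OF that(1)] by (simp add: leg_tuples_def)
    have nm: "\<not> meet k (snd (f i) ! c) (snd (f i) ! c')" if "c < c'" "c' < s" for c c'
      using sorted_wrt_nth_less[OF sorted that(1)] that(2) len[OF \<open>i < t\<close>] by simp
    have "meet k (P i j) (P i j')" "meet k (P i j') (P i j)" using that(4-6) unfolding meet_def by metis+
    then have "\<not> j - 1 < j' - 1" "\<not> j' - 1 < j - 1" using nm that(2,3) unfolding P_def by auto
    then show ?thesis using that(2,3) by auto
  qed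
  have v_SV: "v i \<in> spider_verts k (f i)" for i by (simp add: spider_verts_def v_def)
  have P_SV: "P i j ! a \<in> spider_verts k (f i)" if "i < t" "j \<in> {1..s}" "a \<in> {1..<k}" for i j a
    unfolding spider_verts_def using P_in[OF that(1,2)] that(3) by blast
  show ?thesis
  proof (rule L_graph_embedding[where x = "\<lambda>i j a. P i j ! a" and u = u and v = v and w = w, OF k t G])
    show "{u, v i} \<in> edges G" if "i < t" for i using E_G E_uv[OF that] .
    show "{P i j ! a, P i j ! Suc a} \<in> edges G" if "i < t" "j \<in> {1..s}" "a < k" for i j a
      using P_walk[OF that(1,2)] that(3) by (intro E_G walks_adj)
    show "P i j ! 0 = v i" if "i < t" "j \<in> {1..s}" for i j by (rule P_0[OF that])
    show "P i j ! k = w j" if "i < t" "j \<in> {1..s}" for i j by (rule P_k[OF that])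
    show "inj_on v {..<t}"
    proof (rule inj_onI)
      fix i i' assume "i \<in> {..<t}" "i' \<in> {..<t}" "v i = v i'"
      then show "i = i'" using disjoint[of i i' "v i"] v_SV[of i] v_SV[of i'] by simp
    qed
    have t0: "0 < t" using t by simp
    \<comment> \<open>The feet are read off spider 0, which exists as t >= 1; its legs do not meet
      even at position k.\<close>
    show "inj_on w {1..s}"
    proof (rule inj_onI)
      fix j j' assume j: "j \<in> {1..s}" "j' \<in> {1..s}" "w j = w j'"
      then have "P 0 j ! k = P 0 j' ! k" using P_k[OF t0] by simp
      then show "j = j'" using P_legs[OF t0 j(1,2)] k by simp
    qed
    show "u \<noteq> w j" if "j \<in> {1..s}" for j using P_ne_u[OF t0 that order_refl] P_k[OF t0 that] by simp
    show "v i \<noteq> w j" if "i < t" "j \<in> {1..s}" for i j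
      using P_inj[OF that, of 0 k] P_0[OF that] P_k[OF that] k by auto
    show "P i j ! a \<notin> insert u (v ` {..<t} \<union> w ` {1..s})" if ija: "i < t" "j \<in> {1..s}" "a \<in> {1..<k}" for i j a
    proof
      have a: "a \<le> k" "a \<in> {1..k}" "a \<noteq> 0" "a \<noteq> k" using ija(3) by auto
      assume "P i j ! a \<in> insert u (v ` {..<t} \<union> w ` {1..s})"
      \<comment> \<open>The first case contradicts distinctness of \<open>u # P i j\<close>. In the
        second, the vertex lies on spiders i and i', so i = i' and the leg repeats its start. In the
        third it is the foot of leg j' of the same spider, so j = j' and the leg repeats its
        end.\<close>
      then consider "P i j ! a = u" | i' where "i' < t" "P i j ! a = v i'" | j' where "j' \<in> {1..s}" "P i j ! a = w j'"
        by blast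
      then show False
      proof cases
        case 1
        then show ?thesis using P_ne_u[OF ija(1,2) a(1)] by simp
      next
        case 2
        have "i = i'"
          using disjoint[OF ija(1) 2(1) P_SV[OF ija]] v_SV[of i'] 2(2) by simp
        then have "P i j ! a = P i j ! 0" using 2(2) P_0[OF ija(1,2)] by simp
        then show ?thesis using P_inj[OF ija(1,2) _ a(1)] a(3) by simp
      next
        case 3
        have eq: "P i j ! a = P i j' ! k" using 3 P_k[OF ija(1) 3(1)] by simp
        then have "j = j'" using P_legs[OF ija(1,2) 3(1) _ a(2)] k by simp
        then show ?thesis using P_inj[OF ija(1,2) _ a(1), of k] eq a(4) by simp
      qed
    qed
    show "i = i' \<and> j = j' \<and> a = a'" if ija: "i < t" "j \<in> {1..s}" "a \<in> {1..<k}" "i' < t" "j' \<in> {1..s}" "a' \<in> {1..<k}"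
      and eq: "P i j ! a = P i' j' ! a'" for i j a i' j' a'
    proof -
      have i: "i = i'" using disjoint[OF ija(1,4) P_SV[OF ija(1-3)]] P_SV[OF ija(4-6)] eq by simp
      have a: "a \<in> {1..k}" "a' \<in> {1..k}" "a \<le> k" "a' \<le> k" using ija by auto
      have j: "j = j'" using P_legs[OF ija(1,2,5) _ a(1,2)] eq i by simp
      have "a = a'" using P_inj[OF ija(1,2) _ a(3,4)] eq i j by simp
      then show ?thesis using i j by simp
    qed
  qed
qed

text \<open>B makes each of the k + 1 heavy terms of \<open>card_not_good_walks\<close> at most n
  d^(k + 1) / (8 (k + 1)), and \<open>d1\<close> bounds the walks with repetitions by another
  eighth; together this is the quarter that \<open>many_good_arcs\<close> allows. \<open>d2\<close>
  supplies \<open>large\<close>, and \<open>d3\<close> is the pigeonhole condition, with 2 * 4 ^ s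
  undoing the losses in n d / 2 and d^k / 4.\<close>

lemma contains_copy_if_few_closed_walks:
  fixes G :: "'a graph" and c K :: real and s t k :: nat
  defines "B \<equiv> 8 * real (k + 1) * (c * K) ^ (k + 1)"
  assumes G: "simple_graph G" and E_G: "\<And>x y. E x y \<Longrightarrow> {x, y} \<in> edges G"
    and k: "k \<ge> 1" and t: "t \<ge> 1" and V: "V \<noteq> {}" and c: "c \<ge> 1" and K: "K \<ge> 1" and D: "D = K * d"
    and few: "\<And>j. j \<in> {1..k} \<Longrightarrow> total_closed (2 * j) \<le> real (card V) * (c * d) ^ j"
    and d1: "8 * real ((k + 2)\<^sup>2) * K ^ k \<le> d" and d2: "4 * real s * real (k\<^sup>2) * K ^ k \<le> d"
    and d3: "real (card V) ^ s * (2 * 4 ^ s * (real t * (real (1 + s * k) * ((1 + real k * B) * (real s * B) ^ s)))) < d ^ (s * k + 1)"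
  shows "contains_copy G (L_graph s t k)"
proof -
  let ?n = "real (card V)"
  have n: "?n > 0" using V finite_V by (simp add: card_gt_0_iff)
  have D0: "D \<ge> 0" using D K d_pos by simp
  have cK: "(c * K) ^ (k + 1) \<ge> 1"
    using c K by (intro one_le_power) (metis mult_mono' mult.right_neutral zero_le_one order_trans)
  have B: "B > 0" using cK by (simp add: B_def)
  have level: "total_closed (2 * j) / B * D ^ (Suc k - j) \<le> ?n * d ^ Suc k / (8 * real (k + 1))" if j: "j \<in> {1..k}" for j
  proof -
    have dd: "d ^ j * d ^ (Suc k - j) = d ^ Suc k"
      using j by (simp flip: power_add)
    have "c ^ j * K ^ (Suc k - j) \<le> c ^ (k + 1) * K ^ (k + 1)"
      using c K j by (intro mult_mono power_increasing) auto
    then have ck: "c ^ j * K ^ (Suc k - j) \<le> (c * K) ^ (k + 1)" by (simp only: power_mult_distrib)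
    have "total_closed (2 * j) / B * D ^ (Suc k - j) \<le> ?n * (c * d) ^ j / B * (K * d) ^ (Suc k - j)"
      unfolding D using few[OF j] B K d_pos by (intro mult_right_mono divide_right_mono) auto
    also have "\<dots> = ?n * ((d ^ j * d ^ (Suc k - j)) * (c ^ j * K ^ (Suc k - j))) / B"
      by (simp only: power_mult_distrib times_divide_eq_left times_divide_eq_right mult_ac)
    also have "\<dots> \<le> ?n * (d ^ Suc k * (c * K) ^ (k + 1)) / B"
      unfolding dd using ck d_pos B by (intro divide_right_mono mult_left_mono) auto
    also have "\<dots> = ?n * d ^ Suc k / (8 * real (k + 1))"
    proof -
      have cancel: "a * (y * X) / (b * X) = a * y / b" if "X > 0" for a b y X :: real using that by simp
      have "(c * K) ^ (k + 1) > 0" using cK by linarith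
      then show ?thesis unfolding B_def by (rule cancel)
    qed
    finally show ?thesis .
  qed
  have Dk: "D ^ k = K ^ k * d ^ k" by (simp add: D power_mult_distrib)
  have "real ((k + 2)\<^sup>2) * (?n * D ^ k) = (8 * real ((k + 2)\<^sup>2) * K ^ k) * (?n * d ^ k) / 8"
    unfolding Dk by simp
  also have "\<dots> \<le> d * (?n * d ^ k) / 8"
    using d1 d_pos by (intro divide_right_mono mult_right_mono) auto
  finally have nondist: "real ((k + 2)\<^sup>2) * (?n * D ^ k) \<le> ?n * d ^ Suc k / 8" by (simp add: mult_ac)
  have "(\<Sum>j\<in>{1..k}. total_closed (2 * j) / B * D ^ (Suc k - j)) \<le> (\<Sum>j\<in>{1..k}. ?n * d ^ Suc k / (8 * real (k + 1)))"
    by (intro sum_mono level)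
  moreover have "total_closed (2 * k) / B * D \<le> ?n * d ^ Suc k / (8 * real (k + 1))"
    using level[of k] k by simp
  moreover have "(\<Sum>j\<in>{1..k}. ?n * d ^ Suc k / (8 * real (k + 1))) + ?n * d ^ Suc k / (8 * real (k + 1)) = ?n * d ^ Suc k / 8"
  proof -
    have "(\<Sum>j\<in>{1..k}. X) + X = real (k + 1) * X" for X :: real by (simp add: distrib_right)
    then have "(\<Sum>j\<in>{1..k}. ?n * d ^ Suc k / (8 * real (k + 1))) + ?n * d ^ Suc k / (8 * real (k + 1))
      = real (k + 1) * (?n * d ^ Suc k / (8 * real (k + 1)))" .
    also have "\<dots> = ?n * d ^ Suc k / 8"
    proof -
      have "x * (y / (8 * x)) = y / 8" if "x > 0" for x y :: real using that by simp
      then show ?thesis by (metis of_nat_0_less_iff zero_less_Suc Suc_eq_plus1)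
    qed
    finally show ?thesis .
  qed
  ultimately have bad: "real (card {p \<in> walks (Suc k). \<not> good_walk B k p}) \<le> ?n * d ^ Suc k / 4"
    using card_not_good_walks[OF D0 B, of k] nondist by linarith
  have large: "real s * (real (k\<^sup>2) * D ^ (k - 1)) \<le> d ^ k / 4"
  proof -
    have "K ^ (k - 1) \<le> K ^ k" using K by (intro power_increasing) auto
    then have "real s * (real (k\<^sup>2) * D ^ (k - 1)) \<le> real s * (real (k\<^sup>2) * (K ^ k * d ^ (k - 1)))"
      unfolding D power_mult_distrib using d_pos by (intro mult_left_mono mult_right_mono) auto
    also have "\<dots> = (4 * real s * real (k\<^sup>2) * K ^ k) * d ^ (k - 1) / 4" by simp
    also have "\<dots> \<le> d * d ^ (k - 1) / 4" using d2 d_pos by (intro divide_right_mono mult_right_mono) auto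
    also have "d * d ^ (k - 1) = d ^ k" using k by (simp flip: power_Suc)
    finally show ?thesis .
  qed
  let ?R = "real t * (real (1 + s * k) * ((1 + real k * B) * (real s * B) ^ s))"
  have "?n ^ (s + 1) * ?R = ?n * (?n ^ s * (2 * 4 ^ s * ?R)) / (2 * 4 ^ s)" by simp
  also have "\<dots> < ?n * d ^ (s * k + 1) / (2 * 4 ^ s)"
    using n by (intro divide_strict_right_mono mult_strict_left_mono d3) auto
  also have "\<dots> = ?n * d / 2 * (d ^ k / 4) ^ s"
    by (simp add: power_divide power_mult[symmetric] mult.commute[of s k])
  finally obtain u ws where "?R < real (card (spiders B k s u ws))"
    using many_spiders[OF D0 bad large] by blast
  then show ?thesis using contains_copy_if_many_spiders[OF G E_G k t, of B] B by simp
qed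

end

section \<open>Passing to an almost regular subgraph\<close>

lemma almost_regular_contains_copy:
  fixes K :: real and s t k :: nat
  assumes K: "K \<ge> 1" and t: "t \<ge> 1" and k: "k \<ge> 1"
  shows "\<exists>A>0. \<forall>(V :: 'a set) E d G. almost_regular V E d (K * d) \<longrightarrow> V \<noteq> {} \<longrightarrow> simple_graph G \<longrightarrow>
    (\<forall>x y. E x y \<longrightarrow> {x, y} \<in> edges G) \<longrightarrow> A * real (card V) powr (real s / (real s * real k + 1)) \<le> d \<longrightarrow>
    contains_copy G (L_graph s t k)"
proof -
  define m where "m = 1 + t + s + t * s * (k - 1)"
  define q where "q = 8 * real (t + s) * real ((2 * k + 1)\<^sup>2 + k) + 1"
  \<comment> \<open>With D = K d, the factor c d is exactly the one required in
    \<open>heavy\<close>. It also satisfies c >= K, which settles k = 1 below.\<close>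
  define c where "c = real m * q\<^sup>2 * K"
  define B where "B = 8 * real (k + 1) * (c * K) ^ (k + 1)"
  define C1 where "C1 = 8 * real ((k + 2)\<^sup>2) * K ^ k"
  define C2 where "C2 = 4 * real s * real (k\<^sup>2) * K ^ k"
  define C3 where "C3 = 2 * 4 ^ s * (real t * (real (1 + s * k) * ((1 + real k * B) * (real s * B) ^ s)))"
  \<comment> \<open>A exceeds all three constants. C1 and C2 are compared with d through A <= d, and
    C3 with A^(s k + 1) through 1 <= A.\<close>
  define A where "A = 1 + C1 + C2 + C3"
  have "q \<ge> 1" by (simp add: q_def)
  then have "q\<^sup>2 \<ge> 1" by (rule one_le_power)
  then have "1 * 1 \<le> real m * q\<^sup>2" by (intro mult_mono) (auto simp: m_def)
  then have cK: "c \<ge> K" unfolding c_def using K by (simp add: mult_le_cancel_right1)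
  then have c1: "c \<ge> 1" using K by simp
  have B0: "B \<ge> 0" using c1 K by (simp add: B_def)
  have C: "C1 \<ge> 0" "C2 \<ge> 0" "C3 \<ge> 0" using K B0 by (simp_all add: C1_def C2_def C3_def)
  have main: "contains_copy G (L_graph s t k)"
    if ar: "almost_regular V E d (K * d)" and V: "V \<noteq> {}" and G: "simple_graph G"
      and E_G: "\<And>x y. E x y \<Longrightarrow> {x, y} \<in> edges G"
      and dA: "A * real (card V) powr (real s / (real s * real k + 1)) \<le> d"
    for V :: "'a set" and E d G
  proof -
    interpret almost_regular V E d "K * d" by (rule ar)
    let ?n = "real (card V)"
    have n: "?n \<ge> 1" using V finite_V by (simp add: Suc_leI card_gt_0_iff)
    define r where "r j = total_closed (2 * j)" for j
    have r_pos: "r j > 0" for j using total_closed_pos[OF V] by (simp add: r_def)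
    have r_lc: "(r (Suc j))\<^sup>2 \<le> r j * r (Suc (Suc j))" for j
      unfolding r_def by (rule total_closed_log_convex)
    have r0: "r 0 = ?n" by (simp add: r_def total_closed_0)
    show ?thesis
    proof (cases "k \<ge> 2 \<and> c * d * r (k - 1) \<le> r k")
      case True
      then have k2: "k \<ge> 2" and "real m * q\<^sup>2 * (K * d) * total_closed (2 * (k - 1)) \<le> total_closed (2 * k)"
        by (simp_all add: c_def r_def mult_ac)
      then show ?thesis
        unfolding m_def q_def by (intro contains_copy_if_many_closed_walks[OF G E_G k2 t V])
    next
      case False
      have top: "r k \<le> c * d * r (k - 1)"
      proof (cases "k \<ge> 2")
        case True
        then show ?thesis using False by simp
      next
        case k1: False
        then have "k = 1" using k by simp
        have "r 1 = (\<Sum>z\<in>V. real (card (nbrs z)))" by (simp add: r_def total_closed_def closed_2)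
        also have "\<dots> \<le> (\<Sum>z\<in>V. K * d)" by (intro sum_mono deg_le)
        also have "\<dots> = K * d * ?n" by simp
        also have "\<dots> \<le> c * d * ?n" using cK d_pos n by (intro mult_right_mono) auto
        finally show ?thesis using \<open>k = 1\<close> r0 by simp
      qed
      \<comment> \<open>By log-convexity the last ratio dominates all earlier ones.\<close>
      have step: "r (Suc j) \<le> c * d * r j" if "j < k" for j
      proof -
        have "r (Suc j) * r (k - 1) \<le> r j * r (Suc (k - 1))"
          using that by (intro log_convex_shift r_pos r_lc) auto
        also have "\<dots> \<le> r j * (c * d * r (k - 1))"
          using top k r_pos[of j] by (intro mult_left_mono) auto
        finally have "r (Suc j) * r (k - 1) \<le> (c * d * r j) * r (k - 1)" by (simp add: mult_ac)
        then show ?thesis using r_pos[of "k - 1"] by simp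
      qed
      have few: "j \<le> k \<Longrightarrow> r j \<le> ?n * (c * d) ^ j" for j
      proof (induction j)
        case 0
        then show ?case by (simp add: r0)
      next
        case (Suc j)
        have "r (Suc j) \<le> c * d * r j" using Suc.prems by (intro step) simp
        also have "\<dots> \<le> c * d * (?n * (c * d) ^ j)"
          using Suc c1 d_pos by (intro mult_left_mono) auto
        finally show ?case by (simp add: mult_ac)
      qed
      define \<alpha> where "\<alpha> = real s / (real s * real k + 1)"
      have dA': "A * ?n powr \<alpha> \<le> d" using dA by (simp add: \<alpha>_def)
      have "?n powr \<alpha> \<ge> 1" using n by (intro ge_one_powr_ge_zero) (auto simp: \<alpha>_def)
      then have "A \<le> A * ?n powr \<alpha>" using C by (simp add: A_def)
      then have "A \<le> d" using dA' by simp
      then have d12: "C1 \<le> d" "C2 \<le> d" using C by (simp_all add: A_def)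
      have "(?n powr \<alpha>) ^ (s * k + 1) = (?n powr \<alpha>) powr real (s * k + 1)"
        using n by (intro powr_realpow[symmetric]) simp
      also have "\<dots> = ?n powr (\<alpha> * real (s * k + 1))" by (rule powr_powr)
      also have "\<alpha> * real (s * k + 1) = real s"
      proof -
        have "real s * real k \<ge> 0" by simp
        then have "real s * real k + 1 \<noteq> 0" by linarith
        moreover have "real (s * k + 1) = real s * real k + 1" by simp
        ultimately show ?thesis unfolding \<alpha>_def by (metis nonzero_eq_divide_eq)
      qed
      also have "?n powr real s = ?n ^ s" using n by (simp add: powr_realpow)
      finally have npow: "(?n powr \<alpha>) ^ (s * k + 1) = ?n ^ s" .
      have "C3 < A ^ (s * k + 1)"
      proof -
        have "C3 < A" "1 \<le> A" using C by (simp_all add: A_def)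
        then show ?thesis using self_le_power[of A "s * k + 1"] by linarith
      qed
      then have "?n ^ s * C3 < ?n ^ s * A ^ (s * k + 1)"
        using n by (intro mult_strict_left_mono) auto
      also have "\<dots> = (A * ?n powr \<alpha>) ^ (s * k + 1)"
        using npow by (simp only: power_mult_distrib mult.commute)
      also have "\<dots> \<le> d ^ (s * k + 1)"
        using dA' C by (intro power_mono) (auto simp: A_def)
      finally have d3: "?n ^ s * C3 < d ^ (s * k + 1)" .
      show ?thesis
        using contains_copy_if_few_closed_walks[OF G E_G k t V c1 K refl _ d12[unfolded C1_def C2_def] d3[unfolded C3_def B_def]]
          few unfolding r_def by simp
    qed
  qed
  have "A > 0" using C by (simp add: A_def)
  then show ?thesis using main by blast
qed

text \<open>Y splits into at most |Y| / b + 1 blocks of size at most b, each contributing at most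
  M.\<close>

lemma sum_le_by_small_subsets:
  fixes g :: "'a \<Rightarrow> real"
  assumes "finite Y" and b: "b \<ge> 1" and g: "\<And>y. g y \<ge> 0"
    and small: "\<And>X. X \<subseteq> Y \<Longrightarrow> card X \<le> b \<Longrightarrow> sum g X \<le> M"
  shows "sum g Y \<le> M * (real (card Y) / real b + 1)"
  using assms(1) small
proof (induction "card Y" arbitrary: Y rule: less_induct)
  case less
  have M: "M \<ge> 0" using less.prems(2)[of "{}"] by simp
  show ?case
  proof (cases "card Y \<le> b")
    case True
    then have "sum g Y \<le> M * 1" using less.prems(2)[of Y] by simp
    also have "\<dots> \<le> M * (real (card Y) / real b + 1)" using M by (intro mult_left_mono) auto
    finally show ?thesis .
  next
    case False
    then obtain X where X: "X \<subseteq> Y" "card X = b" using obtain_subset_with_card_n[of b Y] by auto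
    have cY: "card (Y - X) = card Y - b" using X less.prems(1) by (simp add: card_Diff_subset finite_subset)
    have "sum g (Y - X) \<le> M * (real (card (Y - X)) / real b + 1)"
      using less.prems cY b False by (intro less.hyps) auto
    also have "real (card (Y - X)) / real b + 1 = real (card Y) / real b"
      using cY False b by (simp add: of_nat_diff diff_divide_distrib)
    finally have "sum g (Y - X) \<le> M * (real (card Y) / real b)" .
    moreover have "sum g X \<le> M" using X by (intro less.prems(2)) auto
    moreover have "sum g Y = sum g (Y - X) + sum g X" using X less.prems(1) by (simp add: sum.subset_diff)
    ultimately show ?thesis by (simp add: distrib_left)
  qed
qed

definition adj :: "'a graph \<Rightarrow> 'a set \<Rightarrow> 'a \<Rightarrow> 'a \<Rightarrow> bool" where
  "adj G U x y \<longleftrightarrow> x \<in> U \<and> y \<in> U \<and> {x, y} \<in> edges G"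

definition degree_in :: "'a graph \<Rightarrow> 'a set \<Rightarrow> 'a \<Rightarrow> real" where
  "degree_in G U x = real (card {y. adj G U x y})"

definition num_arcs :: "'a graph \<Rightarrow> 'a set \<Rightarrow> real" where
  "num_arcs G U = real (card {(x, y). adj G U x y})"

lemma finite_arcs_in: "finite U \<Longrightarrow> finite {(x, y). adj G U x y}"
  by (rule finite_subset[of _ "U \<times> U"]) (auto simp: adj_def)

lemma finite_adj: "finite U \<Longrightarrow> finite {y. adj G U x y}"
  by (rule finite_subset[of _ U]) (auto simp: adj_def)

lemma adj_sym: "adj G U x y \<longleftrightarrow> adj G U y x"
  by (auto simp: adj_def insert_commute)

lemma card_arcs_from:
  assumes "finite U" "S \<subseteq> U"
  shows "real (card {(x, y). adj G U x y \<and> x \<in> S}) = (\<Sum>x\<in>S. degree_in G U x)"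
proof -
  have "{(x, y). adj G U x y \<and> x \<in> S} = (SIGMA x:S. {y. adj G U x y})" by auto
  moreover have "card (SIGMA x:S. {y. adj G U x y}) = (\<Sum>x\<in>S. card {y. adj G U x y})"
    by (intro card_SigmaI finite_subset[OF assms(2,1)] ballI finite_adj assms(1))
  ultimately have "card {(x, y). adj G U x y \<and> x \<in> S} = (\<Sum>x\<in>S. card {y. adj G U x y})"
    by (simp only:)
  then show ?thesis by (simp add: degree_in_def)
qed

lemma num_arcs_eq: "finite U \<Longrightarrow> num_arcs G U = (\<Sum>x\<in>U. degree_in G U x)"
proof -
  assume "finite U"
  moreover have "{(x, y). adj G U x y} = {(x, y). adj G U x y \<and> x \<in> U}" by (auto simp: adj_def)
  ultimately show ?thesis using card_arcs_from[of U U G] by (simp add: num_arcs_def)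
qed

text \<open>Every lost arc starts or ends in S, and by symmetry both kinds are counted by the degree
  sum over S.\<close>

lemma num_arcs_remove:
  assumes "finite U" "S \<subseteq> U"
  shows "num_arcs G U \<le> num_arcs G (U - S) + 2 * (\<Sum>x\<in>S. degree_in G U x)"
proof -
  let ?F = "{(x, y). adj G U x y \<and> x \<in> S}" and ?T = "{(x, y). adj G U x y \<and> y \<in> S}"
  have fin: "finite ?F" "finite ?T" "finite {(x, y). adj G (U - S) x y}"
    using assms(1) finite_arcs_in[of "U - S" G] by (auto intro: finite_subset[OF _ finite_arcs_in[of U G]])
  have "card ?T = card (prod.swap ` ?F)"
    by (rule arg_cong[where f = card]) (auto simp: adj_sym[of G U] image_iff)
  also have "\<dots> = card ?F" by (intro card_image) simp
  finally have T: "card ?T = card ?F" .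
  have "card {(x, y). adj G U x y} \<le> card ({(x, y). adj G (U - S) x y} \<union> (?F \<union> ?T))"
    using fin by (intro card_mono) (auto simp: adj_def)
  also have "\<dots> \<le> card {(x, y). adj G (U - S) x y} + (card ?F + card ?T)"
    by (intro order.trans[OF card_Un_le] add_left_mono card_Un_le)
  finally have "num_arcs G U \<le> num_arcs G (U - S) + 2 * real (card ?F)" unfolding num_arcs_def T by linarith
  then show ?thesis by (simp add: card_arcs_from[OF assms])
qed

lemma card_edges_le_num_arcs:
  assumes "simple_graph G"
  shows "real (card (edges G)) \<le> num_arcs G (verts G)"
proof -
  have "edges G \<subseteq> (\<lambda>(x, y). {x, y}) ` {(x, y). adj G (verts G) x y}"
  proof
    fix e assume e: "e \<in> edges G"
    then obtain x y where "e = {x, y}" using assms by (auto simp: simple_graph_def card_2_iff)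
    then show "e \<in> (\<lambda>(x, y). {x, y}) ` {(x, y). adj G (verts G) x y}"
      using e assms by (auto simp: simple_graph_def adj_def intro!: image_eqI[of _ _ "(x, y)"])
  qed
  then have "card (edges G) \<le> card {(x, y). adj G (verts G) x y}"
    using assms by (intro surj_card_le finite_arcs_in) (auto simp: simple_graph_def)
  then show ?thesis by (simp add: num_arcs_def)
qed

lemma exists_maximizer:
  fixes f :: "'b \<Rightarrow> real"
  assumes "finite S" "S \<noteq> {}"
  shows "\<exists>x\<in>S. \<forall>y\<in>S. f y \<le> f x"
proof -
  have "Max (f ` S) \<in> f ` S" using assms by (intro Max_in) auto
  then obtain x where "x \<in> S" "f x = Max (f ` S)" by auto
  moreover have "f y \<le> Max (f ` S)" if "y \<in> S" for y using assms that by (intro Max_ge) auto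
  ultimately show ?thesis by (intro bexI[of _ x]) auto
qed

text \<open>Maximising arcs / |U|^(1 + \<open>\<alpha>\<close>) yields a set \<open>U0\<close> in
  which no small subset carries too many arcs. Deleting the vertices of large degree therefore keeps
  half of the arcs, and a second maximisation secures the minimum degree.\<close>

lemma exists_almost_regular_subgraph:
  fixes G :: "'a graph" and \<alpha> A :: real
  assumes G: "simple_graph G" and \<alpha>: "0 < \<alpha>" "\<alpha> \<le> 1" and A: "A > 0"
    and V: "verts G \<noteq> {}"
    and dense: "A * real (card (verts G)) powr (1 + \<alpha>) \<le> real (card (edges G))"
  shows "\<exists>U d. U \<noteq> {} \<and> almost_regular U (adj G U) d (8 * 32 powr (1 / \<alpha>) * d) \<and>
    A / 8 * real (card U) powr \<alpha> \<le> d"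
proof -
  \<comment> \<open>Chosen so that p^\<open>\<alpha>\<close> = 32: the estimate for arcs at
    high-degree vertices reaches 8 a0 / p^\<open>\<alpha>\<close>, and this has to be a0 /
    4.\<close>
  define p :: real where "p = 32 powr (1 / \<alpha>)"
  have p1: "p \<ge> 1" unfolding p_def using \<alpha> by (intro ge_one_powr_ge_zero) auto
  have p\<alpha>: "p powr \<alpha> = 32" using \<alpha> by (simp add: p_def powr_powr)
  have finV: "finite (verts G)" using G by (simp add: simple_graph_def)
  define S where "S = {U. U \<subseteq> verts G \<and> U \<noteq> {}}"
  have finS: "finite S" unfolding S_def by (rule finite_subset[of _ "Pow (verts G)"]) (use finV in auto)
  have VS: "verts G \<in> S" using V by (simp add: S_def)
  define ratio where "ratio U = num_arcs G U / real (card U) powr (1 + \<alpha>)" for U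
  obtain U0 where U0: "U0 \<in> S" and max: "\<And>U. U \<in> S \<Longrightarrow> ratio U \<le> ratio U0"
    using exists_maximizer[OF finS, of ratio] VS by blast
  define \<rho> where "\<rho> = ratio U0"
  have cpos: "real (card U) > 0" if "U \<in> S" for U
    using that finV by (auto simp: S_def card_gt_0_iff intro: finite_subset)
  have "A \<le> ratio (verts G)"
    using dense card_edges_le_num_arcs[OF G] cpos[OF VS] by (simp add: ratio_def pos_le_divide_eq)
  then have \<rho>A: "A \<le> \<rho>" using max[OF VS] by (simp add: \<rho>_def)
  then have \<rho>0: "\<rho> > 0" using A by simp
  have arcs_le: "num_arcs G U \<le> \<rho> * real (card U) powr (1 + \<alpha>)" if "U \<in> S" for U
    using max[OF that] cpos[OF that] by (simp add: \<rho>_def ratio_def[of U] pos_divide_le_eq)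
  have finU0: "finite U0" using U0 finV by (auto simp: S_def intro: finite_subset)
  define v where "v = real (card U0)"
  define a0 where "a0 = num_arcs G U0"
  have v: "v > 0" unfolding v_def by (rule cpos[OF U0])
  have a0: "a0 = \<rho> * v powr (1 + \<alpha>)" using v by (simp add: \<rho>_def ratio_def a0_def v_def)
  then have a0_pos: "a0 > 0" using \<rho>0 v by simp
  have a0v: "a0 / v = \<rho> * v powr \<alpha>" using v by (simp add: a0 powr_add)
  define T where "T = p * a0 / v"
  have T: "T > 0" using p1 a0_pos v by (simp add: T_def)
  \<comment> \<open>Few vertices have large degree, and they meet few arcs: otherwise together with a set of equal size
    they would span a subgraph contradicting the maximality of \<open>U0\<close>.\<close>
  define B where "B = {x \<in> U0. degree_in G U0 x > T}"
  have BU: "B \<subseteq> U0" by (auto simp: B_def)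
  have finB: "finite B" by (rule finite_subset[OF BU finU0])
  have degn: "degree_in G U x \<ge> 0" for U x by (simp add: degree_in_def)
  have "real (card B) * T = (\<Sum>x\<in>B. T)" by simp
  also have "\<dots> \<le> (\<Sum>x\<in>B. degree_in G U0 x)" by (intro sum_mono) (simp add: B_def)
  also have "\<dots> \<le> (\<Sum>x\<in>U0. degree_in G U0 x)" using finU0 BU degn by (intro sum_mono2) auto
  also have "\<dots> = a0" unfolding a0_def by (rule num_arcs_eq[OF finU0, symmetric])
  finally have "real (card B) * (p * a0 / v) \<le> a0" by (simp add: T_def)
  then have "real (card B) * p / v * a0 \<le> 1 * a0" by simp
  then have "real (card B) * p / v \<le> 1" using a0_pos by (rule mult_right_le_imp_le)
  then have cB: "real (card B) \<le> v / p" using v p1 by (simp add: field_simps)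
  have heavy: "4 * (\<Sum>x\<in>B. degree_in G U0 x) \<le> a0"
  proof (cases "B = {}")
    case True
    then show ?thesis using a0_pos by simp
  next
    case False
    define b where "b = card B"
    have b: "b \<ge> 1" using False finB by (simp add: b_def Suc_leI card_gt_0_iff)
    define g where "g y = real (card {x \<in> B. adj G U0 x y})" for y
    \<comment> \<open>By maximality of \<open>U0\<close>, this bounds the arcs inside B together
      with any b further vertices, a set of at most 2 b vertices.\<close>
    define M where "M = \<rho> * (2 * real b) powr (1 + \<alpha>)"
    have small: "sum g X \<le> M" if X: "X \<subseteq> U0" "card X \<le> b" for X
    proof -
      have finX: "finite X" using X finU0 finite_subset by blast
      have fin: "finite {x \<in> B. adj G U0 x y}" for y using finB by simp
      have "sum g X = real (card (SIGMA y:X. {x \<in> B. adj G U0 x y}))"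
        unfolding g_def using finX fin by (subst card_SigmaI) auto
      also have "card (SIGMA y:X. {x \<in> B. adj G U0 x y}) \<le> card {(x, y). adj G (B \<union> X) x y}"
        using finX finB X BU
        by (intro card_inj_on_le[where f = prod.swap] finite_arcs_in) (auto simp: adj_def)
      finally have "sum g X \<le> num_arcs G (B \<union> X)" by (simp add: num_arcs_def)
      also have "\<dots> \<le> \<rho> * real (card (B \<union> X)) powr (1 + \<alpha>)"
        using U0 X BU False by (intro arcs_le) (auto simp: S_def)
      also have "\<dots> \<le> M"
        unfolding M_def using card_Un_le[of B X] X(2) \<rho>0 \<alpha> by (intro mult_left_mono powr_mono2) (auto simp: b_def)
      finally show ?thesis .
    qed
    have M: "M \<ge> 0" using \<rho>0 by (simp add: M_def)
    have bv: "real b \<le> v" using card_mono[OF finU0 BU] by (simp add: b_def v_def)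
    have "(\<Sum>x\<in>B. degree_in G U0 x) = real (card {(x, y). adj G U0 x y \<and> x \<in> B})"
      by (rule card_arcs_from[OF finU0 BU, symmetric])
    also have "card {(x, y). adj G U0 x y \<and> x \<in> B} = card (prod.swap ` (SIGMA y:U0. {x \<in> B. adj G U0 x y}))"
      by (rule arg_cong[where f = card]) (auto simp: adj_def image_iff)
    also have "\<dots> = card (SIGMA y:U0. {x \<in> B. adj G U0 x y})" by (intro card_image) simp
    also have "real \<dots> = sum g U0" unfolding g_def using finU0 finB by (subst card_SigmaI) auto
    also have "\<dots> \<le> M * (v / real b + 1)"
      unfolding v_def using small by (intro sum_le_by_small_subsets finU0 b) (auto simp: g_def)
    also have "\<dots> \<le> M * (2 * (v / real b))"
      using bv b M by (intro mult_left_mono) (auto simp: field_simps)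
    also have "\<dots> = 4 * 2 powr \<alpha> * (\<rho> * v * real b powr \<alpha>)"
      using b by (simp add: M_def powr_mult powr_add)
    also have "\<dots> \<le> 4 * 2 * (\<rho> * v * (v / p) powr \<alpha>)"
    proof (intro mult_mono)
      show "2 powr \<alpha> \<le> (2 :: real)" using powr_mono[of \<alpha> 1 "2 :: real"] \<alpha> by simp
      show "real b powr \<alpha> \<le> (v / p) powr \<alpha>" using cB \<alpha> by (intro powr_mono2) (auto simp: b_def)
    qed (use \<rho>0 v in auto)
    also have "\<dots> = a0 / 4"
      using v p1 by (simp add: a0 powr_divide p\<alpha> powr_add)
    finally show ?thesis by simp
  qed
  define U1 where "U1 = U0 - B"
  \<comment> \<open>An eighth of the average degree of \<open>U0\<close>: charging 2 d per vertex
    then costs at most a0 / 4, less than the a0 / 2 arcs that survive in \<open>U1\<close>.\<close>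
  define d where "d = a0 / (8 * v)"
  have d: "d > 0" using a0_pos v by (simp add: d_def)
  have U1: "num_arcs G U1 \<ge> a0 / 2"
    using num_arcs_remove[OF finU0 BU, of G] heavy by (simp add: U1_def a0_def)
  \<comment> \<open>A maximiser of \<open>\<phi>\<close> replaces iterated deletion of low-degree
    vertices. Removing x loses at most twice its degree in arcs and gains 2 d, so every degree is at
    least d; positivity of the maximum excludes the empty set.\<close>
  define \<phi> where "\<phi> U = num_arcs G U - 2 * d * real (card U)" for U
  have finU1: "finite U1" using finU0 by (simp add: U1_def)
  obtain U2 where U2: "U2 \<subseteq> U1" and max2: "\<And>U. U \<subseteq> U1 \<Longrightarrow> \<phi> U \<le> \<phi> U2"
    using exists_maximizer[of "Pow U1" \<phi>] finU1 Pow_not_empty by (metis PowD PowI finite_Pow_iff)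
  have "card U1 \<le> card U0" unfolding U1_def using finU0 by (intro card_mono) auto
  then have "2 * d * real (card U1) \<le> 2 * d * v" using d unfolding v_def by (intro mult_left_mono) auto
  also have "\<dots> = a0 / 4" using v by (simp add: d_def)
  finally have "\<phi> U1 > 0" using U1 a0_pos by (simp add: \<phi>_def)
  then have \<phi>2: "\<phi> U2 > 0" using max2[of U1] by simp
  have ne: "U2 \<noteq> {}"
  proof
    assume "U2 = {}"
    then show False using \<phi>2 by (simp add: \<phi>_def num_arcs_def adj_def)
  qed
  have finU2: "finite U2" using U2 finU1 finite_subset by blast
  have U20: "U2 \<subseteq> U0" using U2 by (auto simp: U1_def)
  have deg_ge: "d \<le> degree_in G U2 x" if x: "x \<in> U2" for x
  proof -
    have "\<phi> (U2 - {x}) \<le> \<phi> U2" using U2 by (intro max2) auto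
    moreover have "real (card (U2 - {x})) = real (card U2) - 1"
      using x finU2 card_gt_0_iff[of U2] by (auto simp: of_nat_diff Suc_leI)
    moreover have "num_arcs G U2 \<le> num_arcs G (U2 - {x}) + 2 * degree_in G U2 x"
      using num_arcs_remove[OF finU2, of "{x}" G] x by simp
    ultimately show ?thesis by (simp add: \<phi>_def algebra_simps)
  qed
  have deg_le: "degree_in G U2 x \<le> T" if x: "x \<in> U2" for x
  proof -
    have "degree_in G U2 x \<le> degree_in G U0 x"
      unfolding degree_in_def using U20 by (intro of_nat_mono card_mono finite_adj finU0) (auto simp: adj_def)
    moreover have "\<not> degree_in G U0 x > T" using x U2 by (auto simp: U1_def B_def)
    ultimately show ?thesis by simp
  qed
  have T_d: "T = 8 * p * d" using v by (simp add: T_def d_def)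
  interpret finite_simple U2 "adj G U2"
  proof
    show "\<not> adj G U2 x x" for x using G by (auto simp: adj_def simple_graph_def)
  qed (auto simp: adj_def finU2 insert_commute)
  have "degree_in G U2 x = real (card (nbrs x))" for x by (simp add: degree_in_def nbrs_def)
  then have "almost_regular U2 (adj G U2) d (8 * p * d)"
    using d deg_ge deg_le T_d by unfold_locales auto
  moreover have "A / 8 * real (card U2) powr \<alpha> \<le> d"
  proof -
    have "real (card U2) \<le> v" unfolding v_def using card_mono[OF finU0 U20] by simp
    \<comment> \<open>The density passes to \<open>U2\<close> because d is tied to the larger set
      \<open>U0\<close>, where the average degree is \<open>\<rho>\<close> * v powr
      \<open>\<alpha>\<close>.\<close>
    then have "A * real (card U2) powr \<alpha> \<le> \<rho> * v powr \<alpha>"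
      using \<rho>A A \<alpha> by (intro mult_mono powr_mono2) auto
    then show ?thesis using a0v v by (simp add: d_def field_simps)
  qed
  ultimately show ?thesis using ne unfolding p_def by blast
qed

theorem theorem1p12:
  fixes s t k :: nat
  assumes "s \<ge> 1" and "t \<ge> 1" and "k \<ge> 1"
  shows "(\<lambda>n. real (ex_number n (L_graph s t k)))
           \<in> O(\<lambda>n. real n powr (1 + real s / (real s * real k + 1)))"
proof -
  define \<alpha> where "\<alpha> = real s / (real s * real k + 1)"
  define K where "K = 8 * 32 powr (1 / \<alpha>)"
  have "real s * 1 \<le> real s * real k" using assms by (intro mult_left_mono) auto
  then have "real s \<le> real s * real k + 1" "real s * real k + 1 > 0" "real s > 0" using assms(1) by linarith+
  then have \<alpha>: "0 < \<alpha>" "\<alpha> \<le> 1" by (simp_all add: \<alpha>_def pos_divide_le_eq)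
  have "32 powr (1 / \<alpha>) \<ge> 1" using \<alpha> by (intro ge_one_powr_ge_zero) auto
  then have K: "K \<ge> 1" by (simp add: K_def)
  obtain A where A: "A > 0" and contains: "\<And>(V :: nat set) E d G. almost_regular V E d (K * d) \<Longrightarrow> V \<noteq> {} \<Longrightarrow>
      simple_graph G \<Longrightarrow> (\<forall>x y. E x y \<longrightarrow> {x, y} \<in> edges G) \<Longrightarrow> A * real (card V) powr \<alpha> \<le> d \<Longrightarrow>
      contains_copy G (L_graph s t k)"
    using almost_regular_contains_copy[OF K assms(2,3), of s] unfolding \<alpha>_def by blast
  \<comment> \<open>The factor 8 compensates for the division by 8 in
    \<open>exists_almost_regular_subgraph\<close>.\<close>
  have bound: "real (card (edges G)) \<le> 8 * A * real n powr (1 + \<alpha>)"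
    if G: "simple_graph G" "card (verts G) = n" "\<not> contains_copy G (L_graph s t k)" and n: "n \<ge> 1"
    for G :: "nat graph" and n
  proof (rule ccontr)
    assume "\<not> ?thesis"
    then have dense: "8 * A * real (card (verts G)) powr (1 + \<alpha>) \<le> real (card (edges G))" using G(2) by simp
    have "8 * A > 0" "verts G \<noteq> {}" using A n G(2) by auto
    from exists_almost_regular_subgraph[OF G(1) \<alpha> this dense]
    obtain U d where "U \<noteq> {}" "almost_regular U (adj G U) d (K * d)" "8 * A / 8 * real (card U) powr \<alpha> \<le> d"
      unfolding K_def by (elim exE conjE)
    then have "contains_copy G (L_graph s t k)"
      by (intro contains[of U "adj G U" d G] G(1)) (auto simp: adj_def)
    then show False using G(3) by simp
  qed
  have "real (ex_number n (L_graph s t k)) \<le> 8 * A * real n powr (1 + \<alpha>)" if n: "n \<ge> 1" for n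
  proof -
    let ?C = "{card (edges G) | G :: nat graph. simple_graph G \<and> card (verts G) = n \<and> \<not> contains_copy G (L_graph s t k)}"
    have "Max ?C \<in> ?C" using ex_candidates[OF L_graph_has_edge[OF assms(2)]] by (rule Max_in)
    then show ?thesis using bound n unfolding ex_number_def by auto
  qed
  then show ?thesis
    unfolding \<alpha>_def[symmetric]
    by (intro bigoI[where c = "8 * A"] eventually_sequentiallyI[of 1]) simp
qed

end
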